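(* For every $t\ge 0$, the handover probability at time $t$ is the same in the following two networks. (1) Terrestrial model: static base stations (BSs) in $\mathbb{R}^2$ distributed as a homogeneous Poisson point process (PPP) $\Phi_{\rm B}$ of density $\lambda_0>0$; a reference UE moves along a straight line, in a direction uniformly distributed on $[0,2\pi)$, with constant speed $v$, and is at each time served by its nearest BS. (2) Aerial model: drone base stations (DBSs) in the plane $z=h$ ($h>0$) whose positions at time $0$ form a homogeneous PPP $\Phi_{\rm D}(0)$ of density $\lambda_0$ in that plane; each DBS moves, independently of the other DBSs, along a straight line in a uniformly random direction in that plane with the same constant speed $v$ for all DBSs (same speed model); a static typical UE at the origin $\mathbf{o}=(0,0,0)$ is at each time served by its nearest DBS.
   Context: In either model, let $\mathbf{x}_i(s)$, $i\in\mathbb{N}$, be the positions of the (D)BSs relative to the UE of interest at time $s$ (with an arbitrary fixed indexing of the stations). The handover event by time $t$ is $H(t)=\{\exists s<t:\ \arg\min_{i\in\mathbb{N}}\|\mathbf{x}_i(s)\|\neq \arg\min_{i\in\mathbb{N}}\|\mathbf{x}_i(t)\|\}$, and the handover probability at time $t$ is $\mathbb{P}[H(t)]$, the probability that the first handover (change of the nearest, i.e. serving, station) occurs at or before time $t$. *)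

theory Defs
  imports "HOL-Probability.Probability"
begin

definition pcount :: "('w \<Rightarrow> nat \<Rightarrow> 'p) \<Rightarrow> 'p set \<Rightarrow> 'w \<Rightarrow> nat" where
  "pcount X A w = card {i. X w i \<in> A}"

text \<open>Homogeneous Poisson point process of intensity lam in the plane, given as a random
  indexed family of points X w i (arbitrary fixed indexing): the points are random variables,
  a.s. pairwise distinct and locally finite, the number of points in a bounded Borel set A
  is Poisson distributed with mean lam * |A|, and counts in finitely many pairwise disjoint
  bounded Borel sets are independent.\<close>
definition homogeneous_PPP :: "'w measure \<Rightarrow> real \<Rightarrow> ('w \<Rightarrow> nat \<Rightarrow> real^2) \<Rightarrow> bool" where
  "homogeneous_PPP M lam X \<longleftrightarrow>
     (\<forall>i. (\<lambda>w. X w i) \<in> borel_measurable M) \<and>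
     (AE w in M. inj (X w)) \<and>
     (AE w in M. \<forall>A. bounded A \<longrightarrow> finite {i. X w i \<in> A}) \<and>
     (\<forall>A \<in> sets borel. bounded A \<longrightarrow>
        pcount X A \<in> measurable M (count_space UNIV) \<and>
        (\<forall>k. measure M {w \<in> space M. pcount X A w = k} =
              (lam * measure lborel A) ^ k / fact k * exp (- (lam * measure lborel A)))) \<and>
     (\<forall>(J::nat set) (A :: nat \<Rightarrow> (real^2) set).
        finite J \<longrightarrow> (\<forall>j\<in>J. A j \<in> sets borel \<and> bounded (A j)) \<longrightarrow> disjoint_family_on A J \<longrightarrow>
        prob_space.indep_vars M (\<lambda>_. count_space UNIV) (\<lambda>j. pcount X (A j)) J)"

definition indep_rv :: "'w measure \<Rightarrow> 'x measure \<Rightarrow> ('w \<Rightarrow> 'x) \<Rightarrow> 'y measure \<Rightarrow> ('w \<Rightarrow> 'y) \<Rightarrow> bool" where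
  "indep_rv M MA X MB Y \<longleftrightarrow> X \<in> measurable M MA \<and> Y \<in> measurable M MB \<and>
     (\<forall>S \<in> sets MA. \<forall>T \<in> sets MB.
        measure M {w \<in> space M. X w \<in> S \<and> Y w \<in> T} =
        measure M {w \<in> space M. X w \<in> S} * measure M {w \<in> space M. Y w \<in> T})"

definition dir2 :: "real \<Rightarrow> real^2" where
  "dir2 a = vector [cos a, sin a]"

definition lift3 :: "real^2 \<Rightarrow> real \<Rightarrow> real^3" where
  "lift3 p h = vector [p $ 1, p $ 2, h]"

definition serving :: "(nat \<Rightarrow> real) \<Rightarrow> nat set" where
  "serving d = {i. is_arg_min d (\<lambda>_. True) i}"

text \<open>Handover event H(t) for relative positions x s i of the stations at time s.\<close>
definition handover :: "(real \<Rightarrow> nat \<Rightarrow> 'v::real_normed_vector) \<Rightarrow> real \<Rightarrow> bool" where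
  "handover x t \<longleftrightarrow>
     (\<exists>s. 0 \<le> s \<and> s < t \<and> serving (\<lambda>i. norm (x s i)) \<noteq> serving (\<lambda>i. norm (x t i)))"

end

theory Submission
  imports Defs
begin

text \<open>
  In the aerial model rotate each station about the origin, together with its velocity, by minus its
  direction angle. All stations then move with the same velocity, and no distance to the origin has
  changed. The terrestrial model reduces to the same motion by one common random rotation. As the
  Lebesgue measure is rotation invariant, in both cases the rotated points avoid a bounded Borel set
  \<open>A\<close> with probability \<open>exp (- lam |A|)\<close>: for independent angles this is the generating functional
  of the Poisson process, for a common angle it is Fubini. Void events form a \<open>\<pi>\<close>-system, and the
  event that the nearest station never changes is almost surely in the \<open>\<sigma>\<close>-algebra they generate,
  so it has the same probability in both models.
\<close>

subsection \<open>Planar rotations and permanent nearest stations\<close>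

text \<open>The indexing of the stations is arbitrary and may depend on their positions, so the
  Poisson hypotheses do not determine the law of the rotated sequences, and these cannot be compared
  as sequences. Only events about the set of points can be. \<open>handover\<close> mentions indices
  through \<open>serving\<close>; \<open>steady\<close> removes them by describing a permanent
  server with countably many void events. Agreement of void probabilities then suffices (the idea
  behind Renyi's theorem on simple point processes), and neither rotated family has to be shown to
  be Poisson. The description is valid only almost surely: \<open>serving\<close> is a set, and a
  tie would make it larger than a singleton. Excluding ties at time 0 is enough, since without a
  handover the serving set remains the initial singleton. Rotations preserve norms, so this
  exclusion carries over from the unrotated processes.\<close>

definition rot :: "real \<Rightarrow> real^2 \<Rightarrow> real^2" where
  "rot a x = vector [cos a * x $ 1 - sin a * x $ 2, sin a * x $ 1 + cos a * x $ 2]"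

lemma rot_nth [simp]:
  "rot a x $ 1 = cos a * x $ 1 - sin a * x $ 2" "rot a x $ 2 = sin a * x $ 1 + cos a * x $ 2"
  by (simp_all add: rot_def)

lemma rot_rot: "rot a (rot b x) = rot (a + b) x"
  by (simp add: vec_eq_iff forall_2 cos_add sin_add algebra_simps)

lemma rot_0 [simp]: "rot 0 x = x"
  by (simp add: vec_eq_iff forall_2)

lemma rot_add: "rot a (x + y) = rot a x + rot a y"
  by (simp add: vec_eq_iff forall_2 algebra_simps)

lemma rot_scaleR: "rot a (c *\<^sub>R x) = c *\<^sub>R rot a x"
  by (simp add: vec_eq_iff forall_2 algebra_simps)

lemma rot_dir2: "rot a (dir2 b) = dir2 (a + b)"
  by (simp add: vec_eq_iff forall_2 dir2_def cos_add sin_add algebra_simps)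

lemma linear_rot: "linear (rot a)"
  by (intro linearI rot_add rot_scaleR)

lemma orthogonal_transformation_rot: "orthogonal_transformation (rot a)"
proof -
  have "rot a x \<bullet> rot a y = x \<bullet> y" for x y
  proof -
    have "rot a x \<bullet> rot a y = (cos a ^ 2 + sin a ^ 2) * (x $ 1 * y $ 1 + x $ 2 * y $ 2)"
      unfolding inner_vec_def sum_2 rot_nth inner_real_def by algebra
    then show ?thesis by (simp add: inner_vec_def sum_2)
  qed
  then show ?thesis by (simp add: orthogonal_transformation_def linear_rot)
qed

lemma norm_rot [simp]: "norm (rot a x) = norm x"
  using orthogonal_transformation_norm[OF orthogonal_transformation_rot] .

lemma continuous_rot [continuous_intros]:
  fixes f :: "'b::t2_space \<Rightarrow> real"
  assumes "continuous_on S f" "continuous_on S g"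
  shows "continuous_on S (\<lambda>x. rot (f x) (g x))"
proof -
  let ?h = "\<lambda>i x. if i = (1::2) then cos (f x) * g x $ 1 - sin (f x) * g x $ 2
    else sin (f x) * g x $ 1 + cos (f x) * g x $ 2"
  have "continuous_on S (\<lambda>x. \<chi> i. ?h i x)"
  proof (intro continuous_on_vec_lambda)
    fix i :: 2
    show "continuous_on S (?h i)"
      using assms by (cases "i = 1") (auto intro!: continuous_intros)
  qed
  moreover have "(\<lambda>x. \<chi> i. ?h i x) = (\<lambda>x. rot (f x) (g x))"
    by (auto simp: fun_eq_iff vec_eq_iff forall_2)
  ultimately show ?thesis by (simp only:)
qed

lemma borel_measurable_rot [measurable]:
  assumes [measurable]: "f \<in> borel_measurable M" "g \<in> borel_measurable M"
  shows "(\<lambda>x. rot (f x) (g x)) \<in> borel_measurable M"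
proof -
  have "(\<lambda>p. rot (fst p) (snd p)) \<in> borel_measurable borel"
    by (intro borel_measurable_continuous_onI continuous_intros)
  from measurable_compose[OF _ this, of "\<lambda>x. (f x, g x)" M] show ?thesis by simp
qed

lemma measure_rot_vimage:
  assumes A: "A \<in> sets borel" "bounded A"
  shows "measure lborel {x. rot a x \<in> A} = measure lborel A"
proof -
  have "{x. rot a x \<in> A} = rot (- a) ` A"
    by (auto simp: image_iff rot_rot intro!: bexI[of _ "rot a _"])
  moreover have "A \<in> lmeasurable"
    using A by (auto intro: bounded_set_imp_lmeasurable)
  moreover have "{x. rot a x \<in> A} \<in> sets borel" using A by measurable
  \<comment> \<open>The image rule for orthogonal maps concerns \<open>lebesgue\<close>, the
    completion; on Borel sets it agrees with \<open>lborel\<close>.\<close>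
  ultimately show ?thesis
    using measure_orthogonal_image[OF orthogonal_transformation_rot, of A "- a"] A
    by (metis measure_completion sets_lborel)
qed

text \<open>If all stations move with velocity \<open>u\<close>, one that starts outside \<open>reach u t c r\<close> is, throughout
  \<open>[0, t]\<close>, farther from the origin than any that starts in \<open>ball c r\<close>. The strict inequality makes the set open, hence Borel.\<close>
definition reach :: "real^2 \<Rightarrow> real \<Rightarrow> real^2 \<Rightarrow> real \<Rightarrow> (real^2) set" where
  "reach u t c r = (\<Union>s\<in>{0..t}. ball (- (s *\<^sub>R u)) (norm (c + s *\<^sub>R u) + r))"

definition void :: "'p set \<Rightarrow> (nat \<Rightarrow> 'p) set" where
  "void A = {x. \<forall>i. x i \<notin> A}"

text \<open>Some station in \<open>ball c r\<close> is the only one in \<open>reach u t c r\<close>. Uniqueness is expressed by void events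
  alone: at every scale \<open>1 / Suc n\<close>, all points in the region lie in one small ball.\<close>
definition steady :: "real^2 \<Rightarrow> real \<Rightarrow> (real^2) set \<Rightarrow> (nat \<Rightarrow> real^2) set" where
  "steady u t D = (\<Union>c\<in>D. \<Union>r\<in>\<rat> \<inter> {0<..}. \<Inter>n::nat. \<Union>b\<in>D.
     void (reach u t c r - ball b (1 / Suc n)) - void (ball c r \<inter> ball b (1 / Suc n)))"

lemma in_reach: "y \<in> reach u t c r \<longleftrightarrow> (\<exists>s\<in>{0..t}. norm (y + s *\<^sub>R u) < norm (c + s *\<^sub>R u) + r)"
proof -
  have "dist (- (s *\<^sub>R u)) y = norm (y + s *\<^sub>R u)" for s
    by (metis add.commute diff_minus_eq_add dist_commute dist_norm)
  then show ?thesis unfolding reach_def by simp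
qed

lemma open_reach: "open (reach u t c r)"
  unfolding reach_def by auto

lemma bounded_reach: "bounded (reach u t c r)"
proof -
  \<comment> \<open>The drift \<open>t * norm u\<close> enters twice: once to bring \<open>y\<close>
    back to time 0, once for the moving centre \<open>c\<close>.\<close>
  have "norm y \<le> norm c + 2 * t * norm u + r" if y: "y \<in> reach u t c r" for y
  proof -
    from y obtain s where s: "0 \<le> s" "s \<le> t" "norm (y + s *\<^sub>R u) < norm (c + s *\<^sub>R u) + r"
      by (auto simp: in_reach)
    have "norm y \<le> norm (y + s *\<^sub>R u) + norm (s *\<^sub>R u)"
      by (metis add_diff_cancel norm_triangle_ineq4)
    moreover have "norm (c + s *\<^sub>R u) \<le> norm c + norm (s *\<^sub>R u)" by (rule norm_triangle_ineq)
    moreover have "norm (s *\<^sub>R u) \<le> t * norm u" using s by (simp add: mult_right_mono)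
    ultimately show ?thesis using s(3) by linarith
  qed
  then show ?thesis by (auto simp: bounded_iff)
qed

lemma ball_subset_reach: "0 \<le> t \<Longrightarrow> ball c r \<subseteq> reach u t c r"
proof
  fix y assume "0 \<le> t" "y \<in> ball c r"
  then have "norm (y - c) < r" by (simp add: dist_norm norm_minus_commute)
  then have "norm y < norm c + r" using norm_triangle_ineq2[of y c] by linarith
  then show "y \<in> reach u t c r" using \<open>0 \<le> t\<close> by (auto simp: in_reach intro!: bexI[of _ 0])
qed

text \<open>Compactness of \<open>{0..t}\<close> gives a positive gap for each single rival, and
  local finiteness leaves only finitely many rivals that can come close, so the minimum of their
  gaps is positive.\<close>

lemma uniform_gap:
  fixes x :: "nat \<Rightarrow> 'v::real_normed_vector"
  assumes fin: "\<And>R. finite {j. norm (x j) \<le> R}" and t: "0 \<le> t"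
    and less: "\<And>j s. j \<noteq> i \<Longrightarrow> s \<in> {0..t} \<Longrightarrow> norm (x i + s *\<^sub>R u) < norm (x j + s *\<^sub>R u)"
  obtains d where "d > 0" "\<And>j s. j \<noteq> i \<Longrightarrow> s \<in> {0..t} \<Longrightarrow> norm (x i + s *\<^sub>R u) + d \<le> norm (x j + s *\<^sub>R u)"
proof -
  \<comment> \<open>Each station drifts by at most \<open>t * norm u\<close>, so a rival outside
    \<open>J\<close> stays at least 1 farther away than \<open>i\<close>. This is why 1 is among the
    candidates for the minimum \<open>e\<close>.\<close>
  define J where "J = {j. norm (x j) \<le> norm (x i) + 2 * t * norm u + 1}"
  have "\<exists>d>0. \<forall>s\<in>{0..t}. norm (x i + s *\<^sub>R u) + d \<le> norm (x j + s *\<^sub>R u)" if "j \<noteq> i" for j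
  proof -
    let ?f = "\<lambda>s. norm (x j + s *\<^sub>R u) - norm (x i + s *\<^sub>R u)"
    have "\<exists>s\<in>{0..t}. \<forall>s'\<in>{0..t}. ?f s \<le> ?f s'"
      using t by (intro continuous_attains_inf continuous_intros) auto
    then obtain s where "s \<in> {0..t}" "\<And>s'. s' \<in> {0..t} \<Longrightarrow> ?f s \<le> ?f s'" by auto
    then show ?thesis using less[OF that, of s] by (intro exI[of _ "?f s"]) force
  qed
  then obtain d where d: "\<And>j. j \<noteq> i \<Longrightarrow> d j > 0"
    "\<And>j s. j \<noteq> i \<Longrightarrow> s \<in> {0..t} \<Longrightarrow> norm (x i + s *\<^sub>R u) + d j \<le> norm (x j + s *\<^sub>R u)"
    by metis
  define e where "e = Min (insert 1 (d ` (J - {i})))"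
  have finJ: "finite J" unfolding J_def by (rule fin)
  have e_le: "e \<le> 1" "\<And>j. j \<in> J - {i} \<Longrightarrow> e \<le> d j"
    using finJ by (auto simp: e_def)
  have "e > 0" using finJ d by (auto simp: e_def)
  moreover have "norm (x i + s *\<^sub>R u) + e \<le> norm (x j + s *\<^sub>R u)" if j: "j \<noteq> i" and s: "s \<in> {0..t}" for j s
  proof (cases "j \<in> J")
    case True
    then show ?thesis using e_le(2)[of j] d(2)[OF j s] j by auto
  next
    case False
    have "norm (x j) \<le> norm (x j + s *\<^sub>R u) + norm (s *\<^sub>R u)"
      by (metis add_diff_cancel norm_triangle_ineq4)
    moreover have "norm (x i + s *\<^sub>R u) \<le> norm (x i) + norm (s *\<^sub>R u)" by (rule norm_triangle_ineq)
    moreover have "norm (s *\<^sub>R u) \<le> t * norm u" using s by (simp add: mult_right_mono)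
    ultimately show ?thesis using False e_le(1) unfolding J_def mem_Collect_eq by linarith
  qed
  ultimately show thesis by (rule that)
qed

text \<open>If a station in \<open>ball c r\<close> is alone in \<open>reach u t c r\<close>, then
  at every time \<open>norm (c + s *\<^sub>R u) + r\<close> separates its distance from all others.
  Conversely, the uniform gap leaves room to replace the server by a nearby \<open>c\<close> in
  \<open>D\<close> and a rational radius, which keeps all unions countable.\<close>

lemma steady_iff:
  assumes D: "\<And>S. open S \<Longrightarrow> S \<noteq> {} \<Longrightarrow> \<exists>d\<in>D. d \<in> S"
    and fin: "\<And>R. finite {j. norm (x j) \<le> R}" and inj: "inj x" and t: "0 \<le> t"
  shows "x \<in> steady u t D \<longleftrightarrow> (\<exists>i. \<forall>j s. j \<noteq> i \<longrightarrow> s \<in> {0..t} \<longrightarrow> norm (x i + s *\<^sub>R u) < norm (x j + s *\<^sub>R u))"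
    (is "_ \<longleftrightarrow> (\<exists>i. ?N i)")
proof
  assume "x \<in> steady u t D"
  then obtain c r where r: "r \<in> \<rat> \<inter> {0<..}"
    and "x \<in> (\<Inter>n::nat. \<Union>b\<in>D. void (reach u t c r - ball b (1 / Suc n)) - void (ball c r \<inter> ball b (1 / Suc n)))"
    unfolding steady_def by (elim UN_E)
  then have n: "\<exists>b\<in>D. x \<in> void (reach u t c r - ball b (1 / Suc n)) \<and> x \<notin> void (ball c r \<inter> ball b (1 / Suc n))"
    for n :: nat by (simp only: INT_iff UN_iff Diff_iff ball_UNIV)
  from n[of 0] obtain i where i: "x i \<in> ball c r" by (auto simp: void_def)
  have uniq: "j = i" if "x j \<in> reach u t c r" for j
  proof (rule ccontr)
    assume "j \<noteq> i"
    then have "x j \<noteq> x i" using inj by (auto dest: injD)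
    then have pos: "dist (x i) (x j) / 2 > 0" by auto
    \<comment> \<open>Two points in one ball of radius \<open>1 / Suc n\<close> are less than
      \<open>2 / Suc n\<close> apart, which this \<open>n\<close> makes impossible.\<close>
    then obtain n where n': "1 / real (Suc n) < dist (x i) (x j) / 2"
      using reals_Archimedean[OF pos] by (auto simp: inverse_eq_divide add.commute)
    from n[of n] obtain b where b: "x \<in> void (reach u t c r - ball b (1 / Suc n))" by auto
    then have "x i \<in> ball b (1 / Suc n)" "x j \<in> ball b (1 / Suc n)"
      using that i subsetD[OF ball_subset_reach[OF t], of "x i" c r u] by (auto simp: void_def)
    then have "dist b (x i) < 1 / Suc n" "dist b (x j) < 1 / Suc n" by auto
    then show False using n' dist_triangle3[of "x i" "x j" b] by (simp add: add.commute)
  qed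
  have "?N i"
  proof (intro allI impI)
    fix j s assume j: "j \<noteq> i" and s: "s \<in> {0..t}"
    then have "x j \<notin> reach u t c r" using uniq by auto
    then have "norm (c + s *\<^sub>R u) + r \<le> norm (x j + s *\<^sub>R u)" using s by (auto simp: in_reach not_less)
    moreover have "norm (x i + s *\<^sub>R u) < norm (c + s *\<^sub>R u) + r"
    proof -
      have "norm (x i + s *\<^sub>R u) \<le> norm (c + s *\<^sub>R u) + norm (x i - c)"
        by (rule order_trans[OF _ norm_triangle_ineq]) (simp add: algebra_simps)
      then show ?thesis using i by (simp add: dist_norm norm_minus_commute)
    qed
    ultimately show "norm (x i + s *\<^sub>R u) < norm (x j + s *\<^sub>R u)" by simp
  qed
  then show "\<exists>i. ?N i" ..
next
  assume "\<exists>i. ?N i"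
  then obtain i where "?N i" ..
  then obtain d where d: "d > 0" "\<And>j s. j \<noteq> i \<Longrightarrow> s \<in> {0..t} \<Longrightarrow> norm (x i + s *\<^sub>R u) + d \<le> norm (x j + s *\<^sub>R u)"
    using uniform_gap[OF fin t, of i u] by metis
  \<comment> \<open>Half the gap, because \<open>r\<close> is spent twice: on the distance from
    \<open>x i\<close> to \<open>c\<close> and on the margin in \<open>reach\<close>.\<close>
  obtain r where r: "r \<in> \<rat>" "0 < r" "r < d / 2" using Rats_dense_in_real[of 0 "d/2"] d(1) by auto
  obtain c where c: "c \<in> D" "dist (x i) c < r" using D[of "ball (x i) r"] r by auto
  have out: "x j \<notin> reach u t c r" if "j \<noteq> i" for j
  proof
    assume "x j \<in> reach u t c r"
    then obtain s where s: "s \<in> {0..t}" "norm (x j + s *\<^sub>R u) < norm (c + s *\<^sub>R u) + r"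
      by (auto simp: in_reach)
    have "norm (c + s *\<^sub>R u) \<le> norm (x i + s *\<^sub>R u) + norm (c - x i)"
      by (rule order_trans[OF _ norm_triangle_ineq]) (simp add: algebra_simps)
    then show False using s(2) d(2)[OF that s(1)] c(2) r by (simp add: dist_norm norm_minus_commute)
  qed
  have "\<exists>b\<in>D. x \<in> void (reach u t c r - ball b (1 / Suc n)) - void (ball c r \<inter> ball b (1 / Suc n))" for n :: nat
  proof -
    obtain b where b: "b \<in> D" "dist (x i) b < 1 / real (Suc n)"
      using D[of "ball (x i) (1 / real (Suc n))"] by (auto simp: add_nonneg_pos)
    have "x \<in> void (reach u t c r - ball b (1 / Suc n))"
    proof -
      have "x j \<notin> reach u t c r - ball b (1 / Suc n)" for j
        using out[of j] b(2) by (cases "j = i") (auto simp: dist_commute add.commute)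
      then show ?thesis by (simp add: void_def)
    qed
    moreover have "x \<notin> void (ball c r \<inter> ball b (1 / Suc n))"
    proof -
      have "x i \<in> ball c r \<inter> ball b (1 / Suc n)"
        using b(2) c(2) by (simp add: dist_commute add.commute)
      then show ?thesis unfolding void_def by blast
    qed
    ultimately show ?thesis using b(1) by blast
  qed
  then have "x \<in> (\<Inter>n::nat. \<Union>b\<in>D. void (reach u t c r - ball b (1 / Suc n)) - void (ball c r \<inter> ball b (1 / Suc n)))"
    by (intro INT_I) (simp only: UN_iff)
  then show "x \<in> steady u t D" unfolding steady_def using c(1) r(1,2) by (intro UN_I) auto
qed

section \<open>Unique serving stations and the absence of a handover\<close>

lemma serving_eq_singleton: "serving d = {i} \<longleftrightarrow> (\<forall>j. j \<noteq> i \<longrightarrow> d i < d j)"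
proof
  assume s: "serving d = {i}"
  show "\<forall>j. j \<noteq> i \<longrightarrow> d i < d j"
  proof (intro allI impI)
    fix j assume "j \<noteq> i"
    then have "j \<notin> serving d" using s by simp
    then obtain k where "d k < d j" by (auto simp: serving_def is_arg_min_def)
    moreover have "\<not> d k < d i" using s by (auto simp: serving_def is_arg_min_def set_eq_iff)
    ultimately show "d i < d j" by simp
  qed
next
  assume l: "\<forall>j. j \<noteq> i \<longrightarrow> d i < d j"
  show "serving d = {i}"
    unfolding serving_def is_arg_min_def
  proof (intro set_eqI iffI; clarsimp)
    fix k assume "\<forall>y. \<not> d y < d k"
    then show "k = i" using l by blast
  next
    fix y assume "d y < d i"
    then show False using l by (cases "y = i") (auto dest: less_asym)
  qed
qed

lemma ex_serving_singleton:
  assumes fin: "\<And>R. finite {j. d j \<le> R}" and inj: "inj d"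
  shows "\<exists>i. serving d = {i}"
proof -
  let ?K = "{j. d j \<le> d 0}"
  have K: "finite ?K" "?K \<noteq> {}" using fin by auto
  obtain i where i: "i \<in> ?K" "\<And>j. j \<in> ?K \<Longrightarrow> d i \<le> d j"
    using ex_is_arg_min_if_finite[OF K, of d] by (auto simp: is_arg_min_linorder)
  have "d i < d j" if "j \<noteq> i" for j
  proof (cases "j \<in> ?K")
    case True
    then show ?thesis using i(2) that inj by (metis injD order_le_less)
  next
    case False
    then show ?thesis using i(1) by simp
  qed
  then show ?thesis by (auto simp: serving_eq_singleton)
qed

text \<open>Distinct initial distances make the serving set at time 0 a singleton. Absence of a
  handover equates it with the set at time \<open>t\<close>, and hence with the set at every time
  between, so a single station is strictly nearest throughout.\<close>

lemma not_handover_iff_steady: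
  assumes D: "\<And>S. open S \<Longrightarrow> S \<noteq> {} \<Longrightarrow> \<exists>d\<in>D. d \<in> S"
    and fin: "\<And>R. finite {j. norm (x j) \<le> R}" and inj: "inj (\<lambda>i. norm (x i))" and t: "0 < t"
  shows "\<not> handover (\<lambda>s i. x i + s *\<^sub>R u) t \<longleftrightarrow> x \<in> steady u t D"
proof -
  let ?S = "\<lambda>s. serving (\<lambda>i. norm (x i + s *\<^sub>R u))"
  obtain i where i: "?S 0 = {i}"
    using ex_serving_singleton[OF fin inj] by auto
  have "inj x" using inj by (auto simp: inj_def)
  then have st: "x \<in> steady u t D \<longleftrightarrow>
      (\<exists>i. \<forall>j s. j \<noteq> i \<longrightarrow> s \<in> {0..t} \<longrightarrow> norm (x i + s *\<^sub>R u) < norm (x j + s *\<^sub>R u))"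
    by (intro steady_iff) (use D fin t in auto)
  have "\<not> handover (\<lambda>s i. x i + s *\<^sub>R u) t \<longleftrightarrow> (\<exists>i. \<forall>s\<in>{0..t}. ?S s = {i})"
  proof
    assume "\<not> handover (\<lambda>s i. x i + s *\<^sub>R u) t"
    then have *: "\<And>s. 0 \<le> s \<Longrightarrow> s < t \<Longrightarrow> ?S s = ?S t" by (auto simp: handover_def)
    then have "?S t = {i}" using i t *[of 0] by simp
    then show "\<exists>i. \<forall>s\<in>{0..t}. ?S s = {i}" using * by (metis atLeastAtMost_iff order_le_less)
  next
    assume "\<exists>i. \<forall>s\<in>{0..t}. ?S s = {i}"
    then show "\<not> handover (\<lambda>s i. x i + s *\<^sub>R u) t" using t by (auto simp: handover_def)
  qed
  also have "\<dots> \<longleftrightarrow> x \<in> steady u t D"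
    unfolding st serving_eq_singleton by blast
  finally show ?thesis .
qed

subsection \<open>Measurability of the handover event\<close>

text \<open>Compactness reduces an uncountable union of events to countable operations.\<close>
lemma ex_compact_iff_countable:
  fixes g :: "nat \<Rightarrow> 'a::metric_space \<Rightarrow> real"
  assumes K: "compact K" and T: "T \<subseteq> K" "K \<subseteq> closure T" and g: "\<And>j. continuous_on K (g j)"
  shows "(\<exists>s\<in>K. \<forall>j. g j s \<le> 0) \<longleftrightarrow> (\<forall>n. \<exists>q\<in>T. \<forall>j<n. g j q < 1 / Suc n)"
proof
  assume "\<exists>s\<in>K. \<forall>j. g j s \<le> 0"
  then obtain s where s: "s \<in> K" "\<And>j. g j s \<le> 0" by auto
  then obtain q where q: "\<And>k. q k \<in> T" "q \<longlonglongrightarrow> s"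
    using T(2) unfolding closure_sequential by (meson subsetD closure_sequential)
  show "\<forall>n. \<exists>q\<in>T. \<forall>j<n. g j q < 1 / Suc n"
  proof
    fix n
    have "eventually (\<lambda>k. g j (q k) < 1 / Suc n) sequentially" for j
    proof -
      have "(\<lambda>k. g j (q k)) \<longlonglongrightarrow> g j s"
        using q T(1) s(1) by (intro continuous_on_tendsto_compose[OF g] always_eventually) auto
      then show ?thesis
        by (rule order_tendstoD) (use s(2)[of j] in \<open>auto intro: le_less_trans\<close>)
    qed
    then have "eventually (\<lambda>k. \<forall>j\<in>{..<n}. g j (q k) < 1 / Suc n) sequentially"
      by (intro eventually_ball_finite) auto
    then obtain k where "\<forall>j\<in>{..<n}. g j (q k) < 1 / Suc n"
      by (auto simp: eventually_sequentially)
    then show "\<exists>q\<in>T. \<forall>j<n. g j q < 1 / Suc n" using q(1) by auto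
  qed
next
  assume "\<forall>n. \<exists>q\<in>T. \<forall>j<n. g j q < 1 / Suc n"
  then obtain q where q: "\<And>n. q n \<in> T" "\<And>n j. j < n \<Longrightarrow> g j (q n) < 1 / Suc n" by metis
  then obtain s r where s: "s \<in> K" and r: "strict_mono r" "(q \<circ> r) \<longlonglongrightarrow> s"
    using K T(1) unfolding compact_def by (meson subsetD)
  have "g j s \<le> 0" for j
  proof (rule LIMSEQ_le)
    show "(\<lambda>k. g j ((q \<circ> r) k)) \<longlonglongrightarrow> g j s"
      using r q T(1) s by (intro continuous_on_tendsto_compose[OF g] always_eventually) (auto simp: o_def)
    show "(\<lambda>k. 1 / real (Suc (r k))) \<longlonglongrightarrow> 0"
      using LIMSEQ_subseq_LIMSEQ[OF LIMSEQ_Suc[OF lim_1_over_n] r(1)] by (simp add: o_def)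
    \<comment> \<open>A subsequence satisfies \<open>k \<le> r k\<close>, so from
      \<open>k = Suc j\<close> on the index \<open>j\<close> is among those controlled at stage
      \<open>r k\<close>.\<close>
    have "g j ((q \<circ> r) k) \<le> 1 / real (Suc (r k))" if "Suc j \<le> k" for k
      using q(2)[of j "r k"] seq_suble[OF r(1), of k] that by simp
    then show "\<exists>N. \<forall>k\<ge>N. g j ((q \<circ> r) k) \<le> 1 / real (Suc (r k))" by blast
  qed
  then show "\<exists>s\<in>K. \<forall>j. g j s \<le> 0" using s by blast
qed

lemma in_serving: "i \<in> serving d \<longleftrightarrow> (\<forall>j. d i - d j \<le> 0)"
  by (auto simp: serving_def is_arg_min_def not_less)

text \<open>Two serving sets differ iff some station belongs to exactly one of them. Not serving at
  some time is an open condition, so a countable dense set of times detects it; serving at some time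
  is a closed one and needs the compactness argument.\<close>

lemma sets_handover:
  fixes x :: "'w \<Rightarrow> real \<Rightarrow> nat \<Rightarrow> 'v::real_normed_vector"
  assumes meas: "\<And>s i. (\<lambda>w. norm (x w s i)) \<in> borel_measurable M"
    and cont: "\<And>w i. continuous_on UNIV (\<lambda>s. norm (x w s i))"
  shows "{w \<in> space M. handover (x w) t} \<in> sets M"
proof -
  note [measurable] = meas
  let ?S = "\<lambda>w s. serving (\<lambda>i. norm (x w s i))"
  let ?g = "\<lambda>w i j s. norm (x w s i) - norm (x w s j)"
  \<comment> \<open>The times before \<open>t\<close> form a half-open interval, which is exhausted
    by compact ones.\<close>
  define K where "K m = {0..t - 1 / Suc m}" for m
  define T where "T m = (SOME T. countable T \<and> T \<subseteq> K m \<and> K m \<subseteq> closure T)" for m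
  have "countable (T m) \<and> T m \<subseteq> K m \<and> K m \<subseteq> closure (T m)" for m
    unfolding T_def by (rule someI_ex, rule separable[of "K m"]) blast
  then have T: "\<And>m. countable (T m)" "\<And>m. T m \<subseteq> K m" "\<And>m. K m \<subseteq> closure (T m)"
    by simp_all
  have K: "s \<in> {0..<t} \<longleftrightarrow> (\<exists>m. s \<in> K m)" for s
  proof
    assume s: "s \<in> {0..<t}"
    then obtain m where "inverse (real (Suc m)) < t - s" using reals_Archimedean[of "t - s"] by auto
    then show "\<exists>m. s \<in> K m" using s by (intro exI[of _ m]) (auto simp: K_def inverse_eq_divide)
  next
    assume "\<exists>m. s \<in> K m"
    then obtain m where "0 \<le> s" "s \<le> t - 1 / Suc m" by (auto simp: K_def)
    moreover have "1 / real (Suc m) > 0" by simp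
    ultimately have "0 \<le> s \<and> s < t" by linarith
    then show "s \<in> {0..<t}" by simp
  qed
  have cont': "continuous_on A (?g w i j)" for A w i j
    using cont by (intro continuous_on_diff) (auto intro: continuous_on_subset)
  have leave: "(\<exists>s\<in>{0..<t}. i \<notin> ?S w s) \<longleftrightarrow> (\<exists>m j. \<exists>q\<in>T m. ?g w i j q > 0)" for w i
  proof
    assume "\<exists>s\<in>{0..<t}. i \<notin> ?S w s"
    then obtain s where "s \<in> {0..<t}" "i \<notin> ?S w s" by blast
    then obtain m j where s: "s \<in> K m" "?g w i j s > 0" unfolding K in_serving not_all not_le by blast
    then obtain q where q: "\<And>k. q k \<in> T m" "q \<longlonglongrightarrow> s"
      using T(3) by (meson subsetD closure_sequential)
    have "(\<lambda>k. ?g w i j (q k)) \<longlonglongrightarrow> ?g w i j s"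
      using q T(2) s(1) by (intro continuous_on_tendsto_compose[OF cont'[of UNIV]]) auto
    from order_tendstoD(1)[OF this s(2)] obtain k where "?g w i j (q k) > 0"
      by (auto simp: eventually_sequentially)
    then show "\<exists>m j. \<exists>q\<in>T m. ?g w i j q > 0" using q(1) by blast
  next
    assume "\<exists>m j. \<exists>q\<in>T m. ?g w i j q > 0"
    then obtain m j q where "q \<in> K m" "?g w i j q > 0" using T(2) by blast
    then show "\<exists>s\<in>{0..<t}. i \<notin> ?S w s" unfolding in_serving using K[of q] by (auto simp: not_le intro!: bexI[of _ q])
  qed
  have enter: "(\<exists>s\<in>{0..<t}. i \<in> ?S w s) \<longleftrightarrow> (\<exists>m. \<forall>n. \<exists>q\<in>T m. \<forall>j<n. ?g w i j q < 1 / Suc n)" for w i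
  proof -
    have "(\<exists>s\<in>{0..<t}. i \<in> ?S w s) \<longleftrightarrow> (\<exists>m. \<exists>s\<in>K m. \<forall>j. ?g w i j s \<le> 0)"
      unfolding in_serving using K by blast
    also have "\<dots> \<longleftrightarrow> (\<exists>m. \<forall>n. \<exists>q\<in>T m. \<forall>j<n. ?g w i j q < 1 / Suc n)"
      by (intro arg_cong[where f = Ex] ext ex_compact_iff_countable T cont') (simp add: K_def)
    finally show ?thesis .
  qed
  have eq: "handover (x w) t \<longleftrightarrow> (\<exists>i. ((\<forall>j. ?g w i j t \<le> 0) \<and> (\<exists>m j. \<exists>q\<in>T m. ?g w i j q > 0)) \<or>
      (\<not> (\<forall>j. ?g w i j t \<le> 0) \<and> (\<exists>m. \<forall>n. \<exists>q\<in>T m. \<forall>j<n. ?g w i j q < 1 / Suc n)))" for w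
  proof -
    have "handover (x w) t \<longleftrightarrow> (\<exists>i. (i \<in> ?S w t \<and> (\<exists>s\<in>{0..<t}. i \<notin> ?S w s)) \<or> (i \<notin> ?S w t \<and> (\<exists>s\<in>{0..<t}. i \<in> ?S w s)))"
      unfolding handover_def set_eq_iff atLeastLessThan_iff Bex_def by blast
    then show ?thesis unfolding leave enter unfolding in_serving .
  qed
  have countable_Bex: "Measurable.pred M (\<lambda>w. \<exists>q\<in>T m. P w q)"
    if "\<And>q. Measurable.pred M (\<lambda>w. P w q)" for m P
  proof -
    have "{w \<in> space M. \<exists>q\<in>T m. P w q} = (\<Union>q\<in>T m. {w \<in> space M. P w q})" by auto
    also have "\<dots> \<in> sets M" using that T(1) by (intro sets.countable_UN'') (auto simp: pred_def)
    finally show ?thesis by (simp add: pred_def)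
  qed
  have [measurable]: "Measurable.pred M (\<lambda>w. \<exists>q\<in>T m. ?g w i j q > 0)" for m i j
    by (rule countable_Bex) measurable
  have [measurable]: "Measurable.pred M (\<lambda>w. \<exists>q\<in>T m. \<forall>j<n. ?g w i j q < 1 / Suc n)" for m i n
    by (rule countable_Bex) measurable
  show ?thesis unfolding eq by measurable
qed

section \<open>Passing from the elevated plane to planar distances\<close>

lemma handover_cong:
  assumes "\<And>s. serving (\<lambda>i. norm (x s i)) = serving (\<lambda>i. norm (y s i))"
  shows "handover x t \<longleftrightarrow> handover y t"
  unfolding handover_def assms ..

lemma norm_lift3: "norm (lift3 p h) = sqrt ((norm p)\<^sup>2 + h\<^sup>2)"
  by (simp add: norm_vec_def L2_set_def lift3_def sum_2 sum_3 real_sqrt_pow2)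

text \<open>A common height adds the same square to every squared distance, so it does not affect
  which station is nearest.\<close>

lemma norm_lift3_less: "norm (lift3 p h) < norm (lift3 q h) \<longleftrightarrow> norm p < norm q"
proof -
  have "(norm p)\<^sup>2 < (norm q)\<^sup>2 \<longleftrightarrow> norm p < norm q"
    using power2_less_imp_less[of "norm p" "norm q"] power_strict_mono[of "norm p" "norm q" 2] by auto
  then show ?thesis by (simp add: norm_lift3)
qed

subsection \<open>Void events\<close>

abbreviation void_events :: "(nat \<Rightarrow> real^2) set set" where
  "void_events \<equiv> {void A | A. A \<in> sets borel \<and> bounded A}"

lemma void_in_sets [measurable]:
  assumes [measurable]: "A \<in> sets borel"
  shows "void A \<in> sets (PiM UNIV (\<lambda>_. borel :: (real^2) measure))"
proof -
  have "void A = {x \<in> space (PiM UNIV (\<lambda>_. borel :: (real^2) measure)). \<forall>i. x i \<notin> A}"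
    by (simp add: void_def space_PiM)
  also have "\<dots> \<in> sets (PiM UNIV (\<lambda>_. borel))" by measurable
  finally show ?thesis .
qed

lemma sigma_void_subset: "sigma_sets UNIV void_events \<subseteq> sets (PiM UNIV (\<lambda>_. borel :: (real^2) measure))"
proof -
  have "sigma_sets (space (PiM UNIV (\<lambda>_. borel :: (real^2) measure))) void_events
      \<subseteq> sets (PiM UNIV (\<lambda>_. borel :: (real^2) measure))"
    by (rule sets.sigma_sets_subset) (auto intro: void_in_sets)
  then show ?thesis by (simp add: space_PiM)
qed

text \<open>\<open>P\<close> and \<open>Q\<close> live on the product sigma-algebra, whereas void
  events are invariant under permuting the indices and cannot generate it. The Dynkin argument is
  therefore run on the smaller sigma-algebra inside it; intersections stay in the class because
  \<open>void A \<inter> void B = void (A \<union> B)\<close>.\<close>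

lemma void_events_determine:
  assumes P: "prob_space P" "sets P = sets (PiM UNIV (\<lambda>_. borel :: (real^2) measure))"
    and Q: "prob_space Q" "sets Q = sets (PiM UNIV (\<lambda>_. borel :: (real^2) measure))"
    and eq: "\<And>A. A \<in> sets borel \<Longrightarrow> bounded A \<Longrightarrow> measure P (void A) = measure Q (void A)"
    and S: "S \<in> sigma_sets UNIV void_events"
  shows "measure P S = measure Q S"
proof -
  note fin = prob_space.finite_measure[OF P(1)] prob_space.finite_measure[OF Q(1)]
  have sp: "space P = UNIV" "space Q = UNIV"
    using sets_eq_imp_space_eq[OF P(2)] sets_eq_imp_space_eq[OF Q(2)] by (simp_all add: space_PiM)
  have "Int_stable void_events"
  proof (rule Int_stableI)
    fix U W assume "U \<in> void_events" "W \<in> void_events"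
    then obtain A B where AB: "A \<in> sets borel" "bounded A" "U = void A" "B \<in> sets borel" "bounded B" "W = void B"
      by blast
    then have "U \<inter> W = void (A \<union> B)" by (auto simp: void_def)
    moreover have "A \<union> B \<in> sets borel" "bounded (A \<union> B)" using AB by auto
    ultimately show "U \<inter> W \<in> void_events" by blast
  qed
  moreover have "void_events \<subseteq> Pow UNIV" by simp
  ultimately show ?thesis using S
  proof (induction rule: sigma_sets_induct_disjoint)
    case (basic A)
    then show ?case using eq by auto
  next
    case empty
    then show ?case by simp
  next
    case (compl A)
    have "A \<in> sets P" "A \<in> sets Q" using subsetD[OF sigma_void_subset compl(1)] P(2) Q(2) by simp_all
    then show ?case using compl(2) prob_space.prob_compl[OF P(1)] prob_space.prob_compl[OF Q(1)] by (simp add: sp)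
  next
    case (union A)
    have "range A \<subseteq> sets P" "range A \<subseteq> sets Q" using subset_trans[OF union(2) sigma_void_subset] P(2) Q(2) by simp_all
    then have "(\<lambda>i. measure P (A i)) sums measure P (\<Union>i. A i)" "(\<lambda>i. measure Q (A i)) sums measure Q (\<Union>i. A i)"
      using finite_measure.finite_measure_UNION[OF fin(1), of A] finite_measure.finite_measure_UNION[OF fin(2), of A] union(1) by simp_all
    then show ?case unfolding union(3) by (rule sums_unique2)
  qed
qed

lemma steady_in_sigma_void:
  assumes D: "countable D"
  shows "steady u t D \<in> sigma_sets UNIV void_events"
proof -
  have sa: "sigma_algebra UNIV (sigma_sets UNIV void_events)" by (rule sigma_algebra_sigma_sets) simp
  then have ra: "ring_of_sets UNIV (sigma_sets UNIV void_events)"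
    by (intro algebra.axioms sigma_algebra.axioms)
  have v: "void A \<in> sigma_sets UNIV void_events" if "A \<in> sets borel" "bounded A" for A
    using that by (intro sigma_sets.Basic) auto
  have "countable (\<rat> \<inter> {0<..} :: real set)" using countable_rat by auto
  then show ?thesis unfolding steady_def
    using D by (intro sigma_algebra.countable_UN''[OF sa] sigma_algebra.countable_INT''[OF sa] ring_of_sets.Diff[OF ra] v)
      (auto intro: sigma_sets_top bounded_subset[OF bounded_reach] bounded_subset[OF bounded_ball] simp: borel_open[OF open_reach])
qed

subsection \<open>Poisson point processes\<close>

lemma PPP_measurable:
  assumes "homogeneous_PPP M lam X"
  shows "(\<lambda>w. X w i) \<in> borel_measurable M"
  using assms by (simp add: homogeneous_PPP_def)

lemma PPP_finite:
  assumes "homogeneous_PPP M lam X"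
  shows "AE w in M. \<forall>A. bounded A \<longrightarrow> finite {i. X w i \<in> A}"
  using assms by (simp add: homogeneous_PPP_def)

lemma PPP_count:
  assumes "homogeneous_PPP M lam X" "A \<in> sets borel" "bounded A"
  shows "pcount X A \<in> measurable M (count_space UNIV)"
    and "measure M {w \<in> space M. pcount X A w = k} =
           (lam * measure lborel A) ^ k / fact k * exp (- (lam * measure lborel A))"
  using assms by (auto simp: homogeneous_PPP_def)

lemma PPP_indep_vars:
  fixes J :: "nat set"
  assumes "homogeneous_PPP M lam X"
    and "finite J" "\<And>j. j \<in> J \<Longrightarrow> A j \<in> sets borel" "\<And>j. j \<in> J \<Longrightarrow> bounded (A j)" "disjoint_family_on A J"
  shows "prob_space.indep_vars M (\<lambda>_. count_space UNIV) (\<lambda>j. pcount X (A j)) J"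
  by (intro assms(1)[unfolded homogeneous_PPP_def, THEN conjunct2, THEN conjunct2, THEN conjunct2,
        THEN conjunct2, rule_format]) (simp_all add: assms(2-5))

lemma PPP_finite_norm:
  assumes "homogeneous_PPP M lam X"
  shows "AE w in M. \<forall>R. finite {i. norm (X w i) \<le> R}"
  using PPP_finite[OF assms]
proof eventually_elim
  case (elim w)
  have "finite {i. X w i \<in> cball 0 R}" for R using elim bounded_cball by blast
  then show ?case by simp
qed

text \<open>The error of rounding down to a multiple of \<open>1 / Suc n\<close>, used to
  approximate a function by step functions in \<open>PPP_pgfl\<close>.\<close>

lemma abs_floor_mult_diff_le:
  fixes y :: real assumes "0 \<le> y"
  shows "\<bar>nat \<lfloor>real (Suc n) * y\<rfloor> / Suc n - y\<bar> \<le> 1 / Suc n"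
proof -
  let ?k = "nat \<lfloor>real (Suc n) * y\<rfloor>"
  have "0 \<le> real (Suc n) * y" using assms by simp
  then have "real ?k = of_int \<lfloor>real (Suc n) * y\<rfloor>" by simp
  then have "real ?k \<le> real (Suc n) * y" "real (Suc n) * y \<le> real ?k + 1" by linarith+
  then have "\<bar>real ?k - real (Suc n) * y\<bar> \<le> 1" by linarith
  then have "\<bar>real ?k - real (Suc n) * y\<bar> / Suc n \<le> 1 / Suc n"
    by (intro divide_right_mono) simp_all
  moreover have "?k / Suc n - y = (real ?k - real (Suc n) * y) / Suc n"
    by (simp add: diff_divide_distrib del: of_nat_Suc)
  ultimately show ?thesis by (simp del: of_nat_Suc)
qed

lemma indep_rv_commute: "indep_rv M MA X MB Y \<Longrightarrow> indep_rv M MB Y MA X"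
  by (simp add: indep_rv_def conj_commute mult.commute)

section \<open>Void probabilities, ties and the generating functional\<close>

context prob_space
begin

lemma PPP_void:
  assumes X: "homogeneous_PPP M lam X" and A: "A \<in> sets borel" "bounded A"
  shows "measure M {w \<in> space M. \<forall>i. X w i \<notin> A} = exp (- (lam * measure lborel A))"
proof -
  note [measurable] = PPP_measurable[OF X] PPP_count(1)[OF X A] A(1)
  \<comment> \<open>\<open>card\<close> is 0 on infinite sets too, so a zero count means absence of
    points only where the configuration is locally finite, that is, almost surely.\<close>
  have "measure M {w \<in> space M. \<forall>i. X w i \<notin> A} = measure M {w \<in> space M. pcount X A w = 0}"
  proof (rule finite_measure_eq_AE)
    show "AE w in M. w \<in> {w \<in> space M. \<forall>i. X w i \<notin> A} \<longleftrightarrow> w \<in> {w \<in> space M. pcount X A w = 0}"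
      using PPP_finite[OF X] by eventually_elim (use A in \<open>auto simp: pcount_def\<close>)
  qed measurable
  then show ?thesis using PPP_count(2)[OF X A, of 0] by simp
qed

text \<open>With mean \<open>m\<close>, the probability is \<open>1 - (1 + m) * exp (- m)\<close>,
  and \<open>1 - m \<le> exp (- m)\<close> bounds it by \<open>m\<^sup>2\<close>. The quadratic
  order lets a union bound over ever finer partitions tend to 0.\<close>

lemma PPP_at_least_two:
  assumes X: "homogeneous_PPP M lam X" and "0 \<le> lam"
    and A: "A \<in> sets borel" "bounded A"
  shows "measure M {w \<in> space M. 2 \<le> pcount X A w} \<le> (lam * measure lborel A)\<^sup>2"
proof -
  note [measurable] = PPP_count(1)[OF X A]
  let ?m = "lam * measure lborel A"
  let ?E = "\<lambda>k. {w \<in> space M. pcount X A w = k}"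
  have "{w \<in> space M. 2 \<le> pcount X A w} = space M - (?E 0 \<union> ?E 1)" by auto
  then have "measure M {w \<in> space M. 2 \<le> pcount X A w} = 1 - measure M (?E 0 \<union> ?E 1)"
    by (simp add: prob_compl)
  also have "measure M (?E 0 \<union> ?E 1) = measure M (?E 0) + measure M (?E 1)"
    by (intro finite_measure_Union) auto
  also have "\<dots> = (1 + ?m) * exp (- ?m)"
    unfolding PPP_count(2)[OF X A] by (simp add: algebra_simps)
  also have "1 - (1 + ?m) * exp (- ?m) \<le> 1 - (1 + ?m) * (1 - ?m)"
    using exp_ge_add_one_self[of "- ?m"] \<open>0 \<le> lam\<close> by (intro diff_left_mono mult_left_mono) auto
  finally show ?thesis by (simp add: power2_eq_square algebra_simps)
qed

text \<open>The disc is cut into \<open>n\<close> annuli of equal area. Two points of equal norm share an annulus, and a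
  given annulus contains two points with probability \<open>O(1/n\<^sup>2)\<close>.\<close>
lemma PPP_inj_norm_below:
  assumes X: "homogeneous_PPP M lam X" and lam: "0 \<le> lam" and R: "0 < R"
  shows "AE w in M. \<forall>i j. i \<noteq> j \<longrightarrow> norm (X w i) < R \<longrightarrow> norm (X w i) \<noteq> norm (X w j)"
proof -
  note [measurable] = PPP_measurable[OF X]
  let ?E = "{w \<in> space M. \<not> (\<forall>i j. i \<noteq> j \<longrightarrow> norm (X w i) < R \<longrightarrow> norm (X w i) \<noteq> norm (X w j))}"
  \<comment> \<open>The mean number of points in the disc of radius \<open>R\<close>, so each of
    \<open>n\<close> annuli of equal area has mean \<open>V / n\<close>.\<close>
  define V where "V = lam * (unit_ball_vol 2 * R\<^sup>2)"
  have bound: "measure M ?E \<le> V\<^sup>2 / Suc m" for m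
  proof -
    define n where "n = Suc m"
    have n: "n > 0" by (simp add: n_def)
    \<comment> \<open>Area grows with the square of the radius, so square roots of equally spaced
      numbers give equal areas.\<close>
    define rad where "rad k = R * sqrt (real k / n)" for k
    define A where "A k = ball 0 (rad (Suc k)) - (ball 0 (rad k) :: (real^2) set)" for k
    have A: "A k \<in> sets borel" "bounded (A k)" for k
      by (auto simp: A_def intro: bounded_subset[OF bounded_ball])
    note [measurable] = PPP_count(1)[OF X A]
    have rad: "0 \<le> rad k" "rad k \<le> rad (Suc k)" for k
      using R by (auto simp: rad_def divide_right_mono)
    have vol: "lam * measure lborel (A k) = V / n" for k
    proof -
      have "measure lborel (A k) = measure lborel (ball (0::real^2) (rad (Suc k))) - measure lborel (ball (0::real^2) (rad k))"
        unfolding A_def using rad[of k] by (intro measure_Diff) (auto simp: emeasure_ball)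
      also have "\<dots> = unit_ball_vol 2 * (rad (Suc k) ^ 2 - rad k ^ 2)"
        using rad by (simp add: content_ball algebra_simps power2_eq_square)
      also have "rad (Suc k) ^ 2 - rad k ^ 2 = R\<^sup>2 / n"
        by (simp add: rad_def power_mult_distrib algebra_simps add_divide_distrib)
      finally show ?thesis by (simp add: V_def)
    qed
    have "measure M ?E \<le> measure M (\<Union>k\<in>{..<n}. {w \<in> space M. 2 \<le> pcount X (A k) w})"
    proof (rule finite_measure_mono_AE)
      show "AE w in M. w \<in> ?E \<longrightarrow> w \<in> (\<Union>k\<in>{..<n}. {w \<in> space M. 2 \<le> pcount X (A k) w})"
        using PPP_finite[OF X]
      proof eventually_elim
        case (elim w)
        show ?case
        proof
          assume "w \<in> ?E"
          then obtain i j where ij: "w \<in> space M" "i \<noteq> j" "norm (X w i) < R" "norm (X w i) = norm (X w j)" by auto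
          \<comment> \<open>The squared norm on the scale where annulus \<open>k\<close> corresponds
            to the interval from \<open>k\<close> to \<open>k + 1\<close>.\<close>
          define y where "y = n * (norm (X w i) / R)\<^sup>2"
          define k where "k = nat \<lfloor>y\<rfloor>"
          have y: "0 \<le> y" "y < n"
            using ij(3) R n by (auto simp: y_def power_less_one_iff abs_square_less_1)
          have k: "real k \<le> y" "y < Suc k" using y by (auto simp: k_def) linarith+
          have "norm (X w i) = R * sqrt (y / n)"
            using R n by (simp add: y_def real_sqrt_divide real_sqrt_mult)
          then have "rad k \<le> norm (X w i)" "norm (X w i) < rad (Suc k)"
            using k R n by (auto simp: rad_def divide_right_mono divide_strict_right_mono)
          then have "{i, j} \<subseteq> {i. X w i \<in> A k}" using ij by (auto simp: A_def)
          then have "card {i, j} \<le> pcount X (A k) w"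
            unfolding pcount_def using elim A(2) by (intro card_mono) auto
          then have "2 \<le> pcount X (A k) w" using ij by simp
          moreover have "k < n" using k y by linarith
          ultimately show "w \<in> (\<Union>k\<in>{..<n}. {w \<in> space M. 2 \<le> pcount X (A k) w})"
            using ij by blast
        qed
      qed
    qed measurable
    also have "\<dots> \<le> (\<Sum>k<n. measure M {w \<in> space M. 2 \<le> pcount X (A k) w})"
      by (intro finite_measure_subadditive_finite) auto
    also have "\<dots> \<le> (\<Sum>k<n. (V / n)\<^sup>2)"
      using PPP_at_least_two[OF X lam A] unfolding vol by (intro sum_mono)
    also have "\<dots> = V\<^sup>2 / Suc m" using n by (simp add: power2_eq_square n_def)
    finally show ?thesis .
  qed
  have "measure M ?E \<le> 0"
  proof (rule LIMSEQ_le_const)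
    show "(\<lambda>m. V\<^sup>2 / Suc m) \<longlonglongrightarrow> 0"
      using LIMSEQ_Suc[OF lim_const_over_n] .
  qed (use bound in auto)
  then have "measure M ?E = 0" by (simp add: measure_le_0_iff)
  then show ?thesis
    by (intro AE_I[where N = ?E]) (auto simp: emeasure_eq_measure)
qed

text \<open>Stronger than injectivity of the points themselves: no two stations are equidistant from
  the origin, so the initial server is unique.\<close>

lemma PPP_inj_norm:
  assumes X: "homogeneous_PPP M lam X" and lam: "0 \<le> lam"
  shows "AE w in M. inj (\<lambda>i. norm (X w i))"
proof -
  have "AE w in M. \<forall>n. \<forall>i j. i \<noteq> j \<longrightarrow> norm (X w i) < Suc n \<longrightarrow> norm (X w i) \<noteq> norm (X w j)"
    unfolding AE_all_countable[where P = "\<lambda>n w. \<forall>i j. i \<noteq> j \<longrightarrow> norm (X w i) < Suc n \<longrightarrow> norm (X w i) \<noteq> norm (X w j)"]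
    by (intro allI PPP_inj_norm_below[OF X lam]) simp
  then show ?thesis
  proof eventually_elim
    case (elim w)
    have "i = j" if "norm (X w i) = norm (X w j)" for i j
    proof -
      obtain n where "norm (X w i) < real n" using reals_Archimedean2 by blast
      then have "norm (X w i) < real (Suc n)" by simp
      then show ?thesis using elim that by blast
    qed
    then show ?case by (rule injI)
  qed
qed

text \<open>Splitting according to the value of the count and integrating termwise gives the
  exponential series in \<open>lam * measure lborel A * c\<close>. With \<open>0 ^ 0 = 1\<close>,
  the case \<open>c = 0\<close> is the void probability.\<close>

lemma PPP_count_pgf:
  assumes X: "homogeneous_PPP M lam X" and "0 \<le> lam"
    and A: "A \<in> sets borel" "bounded A" and c: "0 \<le> c" "c \<le> 1"
  shows "(\<integral>w. c ^ pcount X A w \<partial>M) = exp (- (lam * measure lborel A * (1 - c)))"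
proof -
  note [measurable] = PPP_count(1)[OF X A]
  let ?m = "lam * measure lborel A"
  let ?E = "\<lambda>k. {w \<in> space M. pcount X A w = k}"
  let ?f = "\<lambda>k w. c ^ k * indicator (?E k) w"
  have int: "(\<integral>w. ?f k w \<partial>M) = (?m * c) ^ k / fact k * exp (- ?m)" for k
    using PPP_count(2)[OF X A, of k] by (simp add: power_mult_distrib mult_ac)
  have sums: "(\<lambda>k. (?m * c) ^ k / fact k * exp (- ?m)) sums (exp (?m * c) * exp (- ?m))"
    using exp_converges[of "?m * c"] by (intro sums_mult2) (simp add: field_simps)
  have single: "(\<lambda>k. ?f k w) sums (c ^ pcount X A w)" if "w \<in> space M" for w
    using sums_If_finite_set[of "{pcount X A w}" "\<lambda>k. c ^ k"] that
    by (auto simp: indicator_def if_distrib cong: if_cong elim!: sums_cong[THEN iffD1, rotated])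
  have "(\<lambda>k. \<integral>w. ?f k w \<partial>M) sums (\<integral>w. (\<Sum>k. ?f k w) \<partial>M)"
  proof (rule sums_integral)
    show "integrable M (?f k)" for k
      by (intro integrable_real_mult_indicator integrable_const) measurable
    show "AE w in M. summable (\<lambda>k. norm (?f k w))"
    proof (intro AE_I2)
      fix w assume "w \<in> space M"
      have "(\<lambda>k. norm (?f k w)) = (\<lambda>k. ?f k w)" using c by auto
      then show "summable (\<lambda>k. norm (?f k w))" using single[OF \<open>w \<in> space M\<close>] by (simp add: sums_iff)
    qed
    have "(\<integral>w. norm (?f k w) \<partial>M) = (\<integral>w. ?f k w \<partial>M)" for k using c by (intro Bochner_Integration.integral_cong) auto
    then show "summable (\<lambda>k. \<integral>w. norm (?f k w) \<partial>M)" using sums unfolding int by (simp add: sums_iff)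
  qed
  moreover have "(\<integral>w. (\<Sum>k. ?f k w) \<partial>M) = (\<integral>w. c ^ pcount X A w \<partial>M)"
    using single by (intro Bochner_Integration.integral_cong) (auto simp: sums_iff)
  ultimately have "(\<integral>w. c ^ pcount X A w \<partial>M) = exp (?m * c) * exp (- ?m)"
    using sums unfolding int by (simp add: sums_iff)
  then show ?thesis by (simp add: exp_add[symmetric] algebra_simps)
qed

text \<open>The generating functional of the step function with value \<open>c k\<close> on
  \<open>B k\<close> and 1 elsewhere: independence over disjoint sets turns the integral into a
  product of count generating functions.\<close>

lemma PPP_pgfl_step:
  fixes n :: nat
  assumes X: "homogeneous_PPP M lam X" and lam: "0 \<le> lam"
    and B: "\<And>k. k \<le> n \<Longrightarrow> B k \<in> sets borel" "\<And>k. k \<le> n \<Longrightarrow> bounded (B k)" "disjoint_family_on B {..n}"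
    and c: "\<And>k. k \<le> n \<Longrightarrow> 0 \<le> c k" "\<And>k. k \<le> n \<Longrightarrow> c k \<le> 1"
  shows "(\<integral>w. (\<Prod>k\<le>n. c k ^ pcount X (B k) w) \<partial>M) = exp (- lam * (\<Sum>k\<le>n. (1 - c k) * measure lborel (B k)))"
proof -
  have "indep_vars (\<lambda>_. count_space UNIV) (\<lambda>k. pcount X (B k)) {..n}"
    using B by (intro PPP_indep_vars[OF X]) auto
  then have ind: "indep_vars (\<lambda>_. borel) (\<lambda>k w. c k ^ pcount X (B k) w) {..n}"
    by (rule indep_vars_compose2) simp
  have "(\<integral>w. (\<Prod>k\<le>n. c k ^ pcount X (B k) w) \<partial>M) = (\<Prod>k\<le>n. \<integral>w. c k ^ pcount X (B k) w \<partial>M)"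
  proof (rule indep_vars_lebesgue_integral[OF _ ind])
    fix k assume k: "k \<in> {..n}"
    note [measurable] = PPP_count(1)[OF X B(1,2)]
    show "integrable M (\<lambda>w. c k ^ pcount X (B k) w)"
      by (rule integrable_const_bound[where B = 1]) (use k c in \<open>auto simp: power_le_one\<close>)
  qed simp
  also have "\<dots> = (\<Prod>k\<le>n. exp (- (lam * measure lborel (B k) * (1 - c k))))"
    by (intro prod.cong PPP_count_pgf[OF X lam] B c) auto
  also have "\<dots> = exp (- lam * (\<Sum>k\<le>n. (1 - c k) * measure lborel (B k)))"
    by (simp add: exp_sum[symmetric] sum_distrib_left sum_negf mult_ac)
  finally show ?thesis .
qed

text \<open>The functional \<open>G\<close> is a measurable version of the random finite product.\<close>
lemma PPP_pgfl:
  assumes X: "homogeneous_PPP M lam X" and lam: "0 \<le> lam"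
    and p [measurable]: "p \<in> borel_measurable borel" and p01: "\<And>x. 0 \<le> p x" "\<And>x. p x \<le> 1"
    and supp: "\<And>x. R < norm x \<Longrightarrow> p x = 0"
    and G [measurable]: "G \<in> borel_measurable M"
    and GP: "AE w in M. G w = (\<Prod>i | norm (X w i) \<le> R. 1 - p (X w i))"
  shows "(\<integral>w. G w \<partial>M) = exp (- lam * (\<integral>x. p x \<partial>lborel))"
proof -
  \<comment> \<open>Level of \<open>p\<close> at resolution \<open>1 / Suc n\<close>. Levels run up
    to \<open>Suc n\<close> inclusive, because \<open>p\<close> may attain 1.\<close>
  define q where "q n x = nat \<lfloor>real (Suc n) * p x\<rfloor>" for n x
  define B where "B n k = {x \<in> cball 0 R. q n x = k}" for n k
  have [measurable]: "q n \<in> measurable borel (count_space UNIV)" for n unfolding q_def by measurable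
  have B: "B n k \<in> sets borel" "bounded (B n k)" for n k
    unfolding B_def by (measurable, rule bounded_subset[OF bounded_cball[of 0 R]]) auto
  note [measurable] = PPP_count(1)[OF X B] B(1)
  have q_le: "q n x \<le> Suc n" for n x
  proof -
    have "real (Suc n) * p x \<le> real (Suc n)" using p01(2)[of x] by (simp add: mult_left_le del: of_nat_Suc)
    then show ?thesis unfolding q_def by linarith
  qed
  have q_le': "q n x / Suc n \<le> 1" for n x using q_le[of n x] by (simp add: divide_le_eq_1 del: of_nat_Suc)
  have q_close: "\<bar>q n x / Suc n - p x\<bar> \<le> 1 / Suc n" for n x
    unfolding q_def by (rule abs_floor_mult_diff_le[OF p01(1)])
  have q_lim: "(\<lambda>n. q n x / Suc n) \<longlonglongrightarrow> p x" for x
  proof (rule LIMSEQ_I)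
    fix r :: real assume "0 < r"
    then obtain N where N: "inverse (real (Suc N)) < r" using reals_Archimedean by blast
    have "norm (q n x / Suc n - p x) < r" if "N \<le> n" for n
    proof -
      have "1 / real (Suc n) \<le> inverse (real (Suc N))" using that by (simp add: field_simps)
      then show ?thesis using q_close[of n x] N by (simp del: of_nat_Suc)
    qed
    then show "\<exists>N. \<forall>n\<ge>N. norm (q n x / Suc n - p x) < r" by blast
  qed
  have q_supp: "q n x = 0" if "R < norm x" for n x using supp[OF that] by (simp add: q_def)
  \<comment> \<open>The product over the points in the disc with \<open>p\<close> rounded to its
    level, grouped by levels so that only counts in disjoint sets appear. By
    \<open>0 ^ 0 = 1\<close>, the top level contributes the factor 1 when its count is 0.\<close>
  define F where "F n w = (\<Prod>k\<le>Suc n. (1 - k / Suc n) ^ pcount X (B n k) w)" for n w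
  have F01: "0 \<le> F n w \<and> F n w \<le> 1" for n w
  proof -
    have "0 \<le> 1 - k / Suc n \<and> 1 - k / Suc n \<le> 1" if "k \<le> Suc n" for k
      using that by (simp add: divide_le_eq_1 del: of_nat_Suc)
    then have "0 \<le> (1 - k / Suc n) ^ m \<and> (1 - k / Suc n) ^ m \<le> 1" if "k \<in> {..Suc n}" for k m
      using that by (metis atMost_iff power_le_one zero_le_power)
    then show ?thesis unfolding F_def by (intro conjI prod_nonneg prod_le_1) blast+
  qed
  have [measurable]: "F n \<in> borel_measurable M" for n unfolding F_def by measurable
  have F_int: "(\<integral>w. F n w \<partial>M) = exp (- lam * (\<integral>x. q n x / Suc n \<partial>lborel))" for n
  proof -
    have "(\<integral>w. F n w \<partial>M) = exp (- lam * (\<Sum>k\<le>Suc n. (1 - (1 - k / Suc n)) * measure lborel (B n k)))"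
      unfolding F_def
      by (rule PPP_pgfl_step[OF X lam]) (use B in \<open>auto simp: B_def disjoint_family_on_def field_simps\<close>)
    also have "(\<Sum>k\<le>Suc n. (1 - (1 - k / Suc n)) * measure lborel (B n k)) =
        (\<integral>x. (\<Sum>k\<le>Suc n. k / Suc n * indicator (B n k) x) \<partial>lborel)"
    proof (subst Bochner_Integration.integral_sum)
      show "integrable lborel (\<lambda>x. k / Suc n * indicator (B n k) x)" for k
        using emeasure_bounded_finite[OF B(2)] by (intro integrable_mult_right integrable_real_indicator) auto
    qed (simp add: emeasure_bounded_finite[OF B(2)] del: of_nat_Suc)
    also have "(\<lambda>x. \<Sum>k\<le>Suc n. k / Suc n * indicator (B n k) x) = (\<lambda>x. q n x / Suc n)"
    proof
      fix x
      have "(\<Sum>k\<le>Suc n. k / Suc n * indicator (B n k) x) = (\<Sum>k\<le>Suc n. if k = q n x then k / Suc n else 0)"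
        by (intro sum.cong) (use q_supp[of x n] in \<open>auto simp: B_def indicator_def\<close>)
      then show "(\<Sum>k\<le>Suc n. k / Suc n * indicator (B n k) x) = q n x / Suc n"
        using q_le[of n x] by simp
    qed
    finally show ?thesis .
  qed
  have F_lim: "(\<lambda>n. \<integral>w. F n w \<partial>M) \<longlonglongrightarrow> (\<integral>w. G w \<partial>M)"
  proof (rule integral_dominated_convergence[where w = "\<lambda>_. 1"])
    show "AE w in M. norm (F n w) \<le> 1" for n
      using F01 by (intro AE_I2) simp
    show "AE w in M. (\<lambda>n. F n w) \<longlonglongrightarrow> G w"
      using PPP_finite[OF X] GP
    proof eventually_elim
      case (elim w)
      let ?I = "{i. norm (X w i) \<le> R}"
      have "finite {i. X w i \<in> cball 0 R}" using elim(1) bounded_cball by blast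
      then have fin: "finite ?I" by simp
      have "F n w = (\<Prod>i\<in>?I. 1 - q n (X w i) / Suc n)" for n
      proof -
        have "F n w = (\<Prod>k\<le>Suc n. \<Prod>i\<in>{i \<in> ?I. q n (X w i) = k}. 1 - q n (X w i) / Suc n)"
          unfolding F_def
        proof (rule prod.cong)
          fix k
          have "{i \<in> ?I. q n (X w i) = k} = {i. X w i \<in> B n k}" by (auto simp: B_def)
          then show "(1 - k / Suc n) ^ pcount X (B n k) w =
              (\<Prod>i\<in>{i \<in> ?I. q n (X w i) = k}. 1 - q n (X w i) / Suc n)"
            by (simp add: pcount_def B_def)
        qed simp
        also have "\<dots> = (\<Prod>i\<in>?I. 1 - q n (X w i) / Suc n)"
          using fin q_le by (intro prod.group) auto
        finally show ?thesis .
      qed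
      then show ?case unfolding elim(2) by (auto intro!: tendsto_intros q_lim simp del: of_nat_Suc)
    qed
  qed auto
  \<comment> \<open>The rounded functions vanish outside the disc and are at most 1, so the
    indicator of the disc dominates them.\<close>
  have q_int_lim: "(\<lambda>n. \<integral>x. q n x / Suc n \<partial>lborel) \<longlonglongrightarrow> (\<integral>x. p x \<partial>lborel)"
  proof (rule integral_dominated_convergence[where w = "indicator (cball 0 R)"])
    show "integrable lborel (indicator (cball (0::real^2) R) :: _ \<Rightarrow> real)"
      using emeasure_bounded_finite[of "cball (0::real^2) R"] by (intro integrable_real_indicator) auto
    show "AE x in lborel. norm (q n x / Suc n) \<le> indicator (cball 0 R) x" for n
      by (intro AE_I2) (use q_le'[of n] q_supp[of _ n] in \<open>auto simp: indicator_def not_le simp del: of_nat_Suc\<close>)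
    show "AE x in lborel. (\<lambda>n. q n x / Suc n) \<longlonglongrightarrow> p x"
      by (intro AE_I2 q_lim)
  qed auto
  have "(\<lambda>n. \<integral>w. F n w \<partial>M) \<longlonglongrightarrow> exp (- lam * (\<integral>x. p x \<partial>lborel))"
    unfolding F_int by (intro tendsto_exp tendsto_mult_left q_int_lim)
  with F_lim show ?thesis by (rule LIMSEQ_unique)
qed

section \<open>Independence as a product law\<close>

lemma indep_rv_joint_distr:
  assumes ind: "indep_rv M MA X MB Y"
  shows "distr M MA X \<Otimes>\<^sub>M distr M MB Y = distr M (MA \<Otimes>\<^sub>M MB) (\<lambda>w. (X w, Y w))"
proof -
  have [measurable]: "X \<in> measurable M MA" "Y \<in> measurable M MB" using ind by (auto simp: indep_rv_def)
  show ?thesis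
  proof (rule pair_measure_eqI)
    fix A B assume "A \<in> sets (distr M MA X)" "B \<in> sets (distr M MB Y)"
    then have A[measurable]: "A \<in> sets MA" and B[measurable]: "B \<in> sets MB" by auto
    have "measure M {w \<in> space M. X w \<in> A \<and> Y w \<in> B} = measure M {w \<in> space M. X w \<in> A} * measure M {w \<in> space M. Y w \<in> B}"
      using ind A B by (simp add: indep_rv_def)
    moreover have "X -` A \<inter> space M = {w \<in> space M. X w \<in> A}" "Y -` B \<inter> space M = {w \<in> space M. Y w \<in> B}"
      "(\<lambda>w. (X w, Y w)) -` (A \<times> B) \<inter> space M = {w \<in> space M. X w \<in> A \<and> Y w \<in> B}" by auto
    ultimately show "emeasure (distr M MA X) A * emeasure (distr M MB Y) B =
        emeasure (distr M (MA \<Otimes>\<^sub>M MB) (\<lambda>w. (X w, Y w))) (A \<times> B)"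
      by (simp add: emeasure_distr emeasure_eq_measure ennreal_mult)
  qed (auto intro!: prob_space_imp_sigma_finite prob_space_distr cong: sets_pair_measure_cong)
qed

text \<open>Conditioning on \<open>X\<close>: the inner probability freezes \<open>X\<close> at its
  value at \<open>w\<close> and redraws \<open>Y\<close> through a separate sample
  \<open>w'\<close>. This is Fubini for the joint law, which independence makes a product.\<close>

lemma indep_rv_Fubini:
  assumes ind: "indep_rv M MA X MB Y" and E [measurable]: "E \<in> sets (MA \<Otimes>\<^sub>M MB)"
  shows "(\<lambda>w. measure M {w' \<in> space M. (X w, Y w') \<in> E}) \<in> borel_measurable M" (is ?meas)
    and "measure M {w \<in> space M. (X w, Y w) \<in> E} = (\<integral>w. measure M {w' \<in> space M. (X w, Y w') \<in> E} \<partial>M)" (is ?eq)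
proof -
  have [measurable]: "X \<in> measurable M MA" "Y \<in> measurable M MB" using ind by (auto simp: indep_rv_def)
  have sf: "sigma_finite_measure (distr M MB Y)"
    by (intro prob_space_imp_sigma_finite prob_space_distr) simp
  show ?meas by measurable
  have "emeasure M {w \<in> space M. (X w, Y w) \<in> E} = emeasure (distr M (MA \<Otimes>\<^sub>M MB) (\<lambda>w. (X w, Y w))) E"
    by (subst emeasure_distr) (auto intro!: arg_cong2[where f = emeasure])
  also have "\<dots> = emeasure (distr M MA X \<Otimes>\<^sub>M distr M MB Y) E"
    by (simp add: indep_rv_joint_distr[OF ind])
  also have "\<dots> = (\<integral>\<^sup>+x. emeasure (distr M MB Y) (Pair x -` E) \<partial>distr M MA X)"
    by (rule sigma_finite_measure.emeasure_pair_measure_alt[OF sf]) simp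
  also have "\<dots> = (\<integral>\<^sup>+w. emeasure (distr M MB Y) (Pair (X w) -` E) \<partial>M)"
    using sigma_finite_measure.measurable_emeasure_Pair[OF sf, of E MA] by (intro nn_integral_distr) (simp_all cong: sets_pair_measure_cong)
  also have "\<dots> = (\<integral>\<^sup>+w. ennreal (measure M {w' \<in> space M. (X w, Y w') \<in> E}) \<partial>M)"
  proof (rule nn_integral_cong)
    fix w assume "w \<in> space M"
    have "Pair (X w) -` E \<in> sets MB" by (rule sets_Pair1[OF E])
    then have "emeasure (distr M MB Y) (Pair (X w) -` E) = emeasure M (Y -` (Pair (X w) -` E) \<inter> space M)"
      by (rule emeasure_distr[rotated]) simp
    also have "Y -` (Pair (X w) -` E) \<inter> space M = {w' \<in> space M. (X w, Y w') \<in> E}" by auto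
    finally show "emeasure (distr M MB Y) (Pair (X w) -` E) = ennreal (measure M {w' \<in> space M. (X w, Y w') \<in> E})"
      by (simp add: emeasure_eq_measure)
  qed
  also have "\<dots> = ennreal (\<integral>w. measure M {w' \<in> space M. (X w, Y w') \<in> E} \<partial>M)"
    by (intro nn_integral_eq_integral integrable_const_bound[where B = 1]) (auto intro: \<open>?meas\<close>)
  finally show ?eq by (simp add: emeasure_eq_measure integral_nonneg_AE)
qed

end

subsection \<open>Randomly rotated Poisson point processes\<close>

lemma bounded_rot_vimage:
  assumes "bounded A" shows "bounded {x. rot a x \<in> A}"
proof -
  obtain R where "\<And>x. x \<in> A \<Longrightarrow> norm x \<le> R" using assms by (auto simp: bounded_iff)
  then have "norm x \<le> R" if "rot a x \<in> A" for x using that by (metis norm_rot)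
  then show ?thesis by (auto simp: bounded_iff)
qed

text \<open>Exchange the integrals: for a fixed angle the points rotated into \<open>A\<close> form
  a set of area \<open>measure lborel A\<close>, and averaging this constant over the probability
  \<open>N\<close> leaves it unchanged.\<close>

lemma integral_hit_probability:
  fixes f :: "real \<Rightarrow> real"
  assumes N: "prob_space N" "sets N = sets borel" and f [measurable]: "f \<in> borel_measurable borel"
    and A [measurable]: "A \<in> sets borel" and bA: "bounded A"
  shows "(\<lambda>x. measure N {a. rot (f a) x \<in> A}) \<in> borel_measurable borel"
    and "(\<integral>x. measure N {a. rot (f a) x \<in> A} \<partial>lborel) = measure lborel A"
proof -
  note [measurable_cong] = N(2)
  have pair: "pair_sigma_finite lborel N"
    by (intro pair_sigma_finite.intro sigma_finite_lborel prob_space_imp_sigma_finite N(1))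
  have sp: "space N = UNIV" using N(2) by (metis sets_eq_imp_space_eq space_borel)
  let ?p = "\<lambda>x. measure N {a. rot (f a) x \<in> A}"
  have [measurable]: "{a. rot (f a) x \<in> A} \<in> sets N" for x
    using N(2) by simp
  have "?p = (\<lambda>x. \<integral>a. indicator A (rot (f a) x) \<partial>N)"
  proof
    fix x
    have "(\<integral>a. indicator A (rot (f a) x) \<partial>N) = (\<integral>a. indicator {a. rot (f a) x \<in> A} a \<partial>N :: real)"
      by (intro Bochner_Integration.integral_cong) (auto simp: indicator_def)
    then show "?p x = (\<integral>a. indicator A (rot (f a) x) \<partial>N)" by (simp add: sp)
  qed
  also have "\<dots> \<in> borel_measurable borel"
    by (rule sigma_finite_measure.borel_measurable_lebesgue_integral[OF prob_space_imp_sigma_finite[OF N(1)]])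
      measurable
  finally show meas: "?p \<in> borel_measurable borel" .
  have "(\<integral>\<^sup>+x. ?p x \<partial>lborel) = (\<integral>\<^sup>+x. \<integral>\<^sup>+a. indicator A (rot (f a) x) \<partial>N \<partial>lborel)"
  proof (intro nn_integral_cong)
    fix x
    have "(\<integral>\<^sup>+a. indicator A (rot (f a) x) \<partial>N) = (\<integral>\<^sup>+a. indicator {a. rot (f a) x \<in> A} a \<partial>N)"
      by (intro nn_integral_cong) (auto simp: indicator_def)
    then show "ennreal (?p x) = (\<integral>\<^sup>+a. indicator A (rot (f a) x) \<partial>N)" by (simp add: finite_measure.emeasure_eq_measure[OF prob_space.finite_measure[OF N(1)]])
  qed
  also have "\<dots> = (\<integral>\<^sup>+a. \<integral>\<^sup>+x. indicator A (rot (f a) x) \<partial>lborel \<partial>N)"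
    by (rule pair_sigma_finite.Fubini'[OF pair, symmetric]) measurable
  also have "\<dots> = (\<integral>\<^sup>+a. ennreal (measure lborel A) \<partial>N)"
  proof (intro nn_integral_cong)
    fix a
    have "(\<integral>\<^sup>+x. indicator A (rot (f a) x) \<partial>lborel) = (\<integral>\<^sup>+x. indicator {x. rot (f a) x \<in> A} x \<partial>lborel)"
      by (intro nn_integral_cong) (auto simp: indicator_def)
    also have "\<dots> = emeasure lborel {x. rot (f a) x \<in> A}" by (rule nn_integral_indicator) simp
    also have "\<dots> = ennreal (measure lborel {x. rot (f a) x \<in> A})"
      using emeasure_bounded_finite[OF bounded_rot_vimage[OF bA], of "f a"]
      by (intro emeasure_eq_ennreal_measure) auto
    finally show "(\<integral>\<^sup>+x. indicator A (rot (f a) x) \<partial>lborel) = ennreal (measure lborel A)"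
      by (simp add: measure_rot_vimage[OF A bA])
  qed
  also have "\<dots> = ennreal (measure lborel A)" by (simp add: prob_space.emeasure_space_1[OF N(1)])
  finally show "(\<integral>x. ?p x \<partial>lborel) = measure lborel A"
    using meas by (subst integral_eq_nn_integral) auto
qed

context prob_space
begin

text \<open>Condition on the angle. Avoiding \<open>A\<close> after a fixed rotation means that the
  original process avoids the preimage of \<open>A\<close>, which has the same area.\<close>

lemma void_common_rotation:
  fixes f :: "real \<Rightarrow> real"
  assumes X: "homogeneous_PPP M lam X"
    and ind: "indep_rv M (PiM UNIV (\<lambda>_. borel)) X borel \<alpha>" and f [measurable]: "f \<in> borel_measurable borel"
    and A [measurable]: "A \<in> sets borel" and bA: "bounded A"
  shows "measure M {w \<in> space M. \<forall>i. rot (f (\<alpha> w)) (X w i) \<notin> A} = exp (- (lam * measure lborel A))"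
proof -
  define E where "E = {z :: real \<times> (nat \<Rightarrow> real^2). \<forall>i. rot (f (fst z)) (snd z i) \<notin> A}"
  have "E = {z \<in> space (borel \<Otimes>\<^sub>M PiM UNIV (\<lambda>_. borel)). \<forall>i. rot (f (fst z)) (snd z i) \<notin> A}"
    by (simp add: E_def space_pair_measure space_PiM)
  also have "\<dots> \<in> sets (borel \<Otimes>\<^sub>M PiM UNIV (\<lambda>_. borel))" by measurable
  finally have E: "E \<in> sets (borel \<Otimes>\<^sub>M PiM UNIV (\<lambda>_. borel))" .
  have in_E: "(a, x) \<in> E \<longleftrightarrow> (\<forall>i. rot (f a) (x i) \<notin> A)" for a x by (simp add: E_def)
  have "measure M {w \<in> space M. \<forall>i. rot (f (\<alpha> w)) (X w i) \<notin> A} =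
      (\<integral>w. measure M {w' \<in> space M. \<forall>i. rot (f (\<alpha> w)) (X w' i) \<notin> A} \<partial>M)"
    using indep_rv_Fubini(2)[OF indep_rv_commute[OF ind] E] by (simp only: in_E)
  also have "\<dots> = (\<integral>w. exp (- (lam * measure lborel A)) \<partial>M)"
  proof (intro Bochner_Integration.integral_cong refl)
    fix w
    have "measure M {w' \<in> space M. \<forall>i. X w' i \<notin> {x. rot (f (\<alpha> w)) x \<in> A}} =
        exp (- (lam * measure lborel {x. rot (f (\<alpha> w)) x \<in> A}))"
      by (intro PPP_void[OF X] bounded_rot_vimage bA) measurable
    then show "measure M {w' \<in> space M. \<forall>i. rot (f (\<alpha> w)) (X w' i) \<notin> A} = exp (- (lam * measure lborel A))"
      by (simp add: measure_rot_vimage[OF A bA])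
  qed
  finally show ?thesis by (simp add: prob_space)
qed

text \<open>Condition on the positions instead. The angles are independent, so the conditional void
  probability is a product of miss probabilities \<open>1 - ?p (X w i)\<close>. Its expectation is a
  generating functional, and the integral of \<open>?p\<close> is the area of
  \<open>A\<close>.\<close>

lemma void_iid_rotation:
  fixes f :: "real \<Rightarrow> real"
  assumes X: "homogeneous_PPP M lam X" and lam: "0 \<le> lam"
    and ind: "indep_rv M (PiM UNIV (\<lambda>_. borel)) X (PiM UNIV (\<lambda>_. borel)) \<alpha>"
    and N: "prob_space N" "sets N = sets borel" and law: "\<And>i. distr M borel (\<lambda>w. \<alpha> w i) = N"
    and iid: "prob_space.indep_vars M (\<lambda>_. borel) (\<lambda>i w. \<alpha> w i) UNIV" and f [measurable]: "f \<in> borel_measurable borel"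
    and A [measurable]: "A \<in> sets borel" and bA: "bounded A"
  shows "measure M {w \<in> space M. \<forall>i. rot (f (\<alpha> w i)) (X w i) \<notin> A} = exp (- (lam * measure lborel A))"
proof -
  \<comment> \<open>Rotations preserve norms, so a station farther out than \<open>R\<close> cannot
    be rotated into \<open>A\<close> and the infinite product is finite.\<close>
  obtain R where R: "\<And>x. x \<in> A \<Longrightarrow> norm x \<le> R" using bA by (auto simp: bounded_iff)
  have [measurable]: "(\<lambda>w. \<alpha> w i) \<in> borel_measurable M" for i
    using iid by (simp add: indep_vars_def)
  let ?p = "\<lambda>x. measure N {a. rot (f a) x \<in> A}"
  define E where "E = {z :: (nat \<Rightarrow> real^2) \<times> (nat \<Rightarrow> real). \<forall>i. rot (f (snd z i)) (fst z i) \<notin> A}"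
  have "E = {z \<in> space (PiM UNIV (\<lambda>_. borel) \<Otimes>\<^sub>M PiM UNIV (\<lambda>_. borel)). \<forall>i. rot (f (snd z i)) (fst z i) \<notin> A}"
    by (simp add: E_def space_pair_measure space_PiM)
  also have "\<dots> \<in> sets (PiM UNIV (\<lambda>_. borel) \<Otimes>\<^sub>M PiM UNIV (\<lambda>_. borel))" by measurable
  finally have E: "E \<in> sets (PiM UNIV (\<lambda>_. borel) \<Otimes>\<^sub>M PiM UNIV (\<lambda>_. borel))" .
  have in_E: "(x, a) \<in> E \<longleftrightarrow> (\<forall>i. rot (f (a i)) (x i) \<notin> A)" for a x by (simp add: E_def)
  let ?G = "\<lambda>w. measure M {w' \<in> space M. \<forall>i. rot (f (\<alpha> w' i)) (X w i) \<notin> A}"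
  have miss: "measure M {w \<in> space M. rot (f (\<alpha> w i)) x \<notin> A} = 1 - ?p x" for i x
  proof -
    have [measurable]: "{a. rot (f a) x \<in> A} \<in> sets borel" by measurable
    have "?p x = measure (distr M borel (\<lambda>w. \<alpha> w i)) {a. rot (f a) x \<in> A}" by (simp add: law)
    also have "\<dots> = measure M {w \<in> space M. rot (f (\<alpha> w i)) x \<in> A}"
      by (subst measure_distr) (auto intro!: arg_cong[where f = "measure M"])
    finally have "1 - ?p x = measure M (space M - {w \<in> space M. rot (f (\<alpha> w i)) x \<in> A})"
      by (subst prob_compl) auto
    also have "space M - {w \<in> space M. rot (f (\<alpha> w i)) x \<in> A} = {w \<in> space M. rot (f (\<alpha> w i)) x \<notin> A}" by auto
    finally show ?thesis by simp
  qed
  have "measure M {w \<in> space M. \<forall>i. rot (f (\<alpha> w i)) (X w i) \<notin> A} = (\<integral>w. ?G w \<partial>M)"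
    using indep_rv_Fubini(2)[OF ind E] by (simp only: in_E)
  also have "\<dots> = exp (- lam * (\<integral>x. ?p x \<partial>lborel))"
  proof (rule PPP_pgfl[OF X lam integral_hit_probability(1)[OF N f A bA], where R = R])
    show "?p x = 0" if "R < norm x" for x
    proof -
      have "{a. rot (f a) x \<in> A} = {}" using that R by (force simp: not_le)
      then show ?thesis by simp
    qed
    show "?p x \<le> 1" for x by (rule prob_space.prob_le_1[OF N(1)])
    show "?G \<in> borel_measurable M" using indep_rv_Fubini(1)[OF ind E] by (simp only: in_E)
    show "AE w in M. ?G w = (\<Prod>i | norm (X w i) \<le> R. 1 - ?p (X w i))"
      using PPP_finite[OF X]
    proof eventually_elim
      case (elim w)
      let ?I = "{i. norm (X w i) \<le> R}"
      have "finite {i. X w i \<in> cball 0 R}" using elim bounded_cball by blast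
      then have fin: "finite ?I" by simp
      have eq: "{w' \<in> space M. \<forall>i. rot (f (\<alpha> w' i)) (X w i) \<notin> A} =
          {w' \<in> space M. \<forall>i\<in>?I. rot (f (\<alpha> w' i)) (X w i) \<notin> A}"
      proof -
        have "i \<in> ?I" if "rot a (X w i) \<in> A" for a i using R[OF that] by simp
        then show ?thesis by blast
      qed
      show ?case
      \<comment> \<open>The product rule for independent variables needs a nonempty index set; with
        no station in range the event is the whole space.\<close>
      proof (cases "?I = {}")
        case True
        then show ?thesis unfolding eq by (simp add: prob_space del: Collect_empty_eq)
      next
        case False
        have "{w' \<in> space M. \<forall>i\<in>?I. rot (f (\<alpha> w' i)) (X w i) \<notin> A} =
            (\<Inter>i\<in>?I. (\<lambda>w'. \<alpha> w' i) -` {a. rot (f a) (X w i) \<notin> A} \<inter> space M)" using False by auto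
        also have "measure M \<dots> = (\<Prod>i\<in>?I. measure M ((\<lambda>w'. \<alpha> w' i) -` {a. rot (f a) (X w i) \<notin> A} \<inter> space M))"
          using False fin by (intro indep_varsD[OF iid]) auto
        also have "\<dots> = (\<Prod>i\<in>?I. 1 - ?p (X w i))"
        proof (intro prod.cong refl)
          fix i
          have "(\<lambda>w'. \<alpha> w' i) -` {a. rot (f a) (X w i) \<notin> A} \<inter> space M =
              {w' \<in> space M. rot (f (\<alpha> w' i)) (X w i) \<notin> A}" by auto
          then show "measure M ((\<lambda>w'. \<alpha> w' i) -` {a. rot (f a) (X w i) \<notin> A} \<inter> space M) = 1 - ?p (X w i)"
            by (simp only: miss)
        qed
        finally show ?thesis unfolding eq .
      qed
    qed
  qed simp
  finally show ?thesis by (simp add: integral_hit_probability(2)[OF N f A bA])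
qed

section \<open>Handover probabilities from void probabilities\<close>

lemma prob_handover_eq_steady:
  fixes X :: "'a \<Rightarrow> nat \<Rightarrow> real^2"
  assumes [measurable]: "\<And>i. (\<lambda>w. X w i) \<in> borel_measurable M"
    and inj: "AE w in M. inj (\<lambda>i. norm (X w i))" and fin: "AE w in M. \<forall>R. finite {i. norm (X w i) \<le> R}"
    and t: "0 < t" and D: "countable D" "\<And>S. open S \<Longrightarrow> S \<noteq> {} \<Longrightarrow> \<exists>d\<in>D. d \<in> S"
  shows "measure M {w \<in> space M. handover (\<lambda>s i. X w i + s *\<^sub>R u) t} =
     1 - measure (distr M (PiM UNIV (\<lambda>_. borel)) X) (steady u t D)"
proof -
  let ?H = "{w \<in> space M. handover (\<lambda>s i. X w i + s *\<^sub>R u) t}"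
  have X [measurable]: "X \<in> measurable M (PiM UNIV (\<lambda>_. borel))"
    by (rule measurable_PiM_single') auto
  have H: "?H \<in> sets M"
    by (rule sets_handover) (auto intro!: continuous_intros)
  have S [measurable]: "steady u t D \<in> sets (PiM UNIV (\<lambda>_. borel))"
    using steady_in_sigma_void[OF D(1)] sigma_void_subset by blast
  have "measure (distr M (PiM UNIV (\<lambda>_. borel)) X) (steady u t D) = measure M (X -` steady u t D \<inter> space M)"
    by (rule measure_distr) measurable
  \<comment> \<open>The two events agree only off a null set of ties and accumulations, so
    measurability of the handover event has to come separately, from
    \<open>sets_handover\<close>.\<close>
  also have "\<dots> = measure M (space M - ?H)"
  proof (rule finite_measure_eq_AE)
    show "AE w in M. w \<in> X -` steady u t D \<inter> space M \<longleftrightarrow> w \<in> space M - ?H"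
      using inj fin
    proof eventually_elim
      case (elim w)
      then show ?case using not_handover_iff_steady[of D "X w" t u] D(2) t by auto
    qed
  qed (use H in measurable)
  also have "\<dots> = 1 - measure M ?H" using H by (rule prob_compl)
  finally show ?thesis by simp
qed

end

text \<open>The laws of the two sequences may differ on the product sigma-algebra. They agree on the
  sigma-algebra of void events, and \<open>steady u t D\<close> lies there once \<open>D\<close> is
  countable.\<close>

lemma prob_handover_unique:
  fixes X :: "'v \<Rightarrow> nat \<Rightarrow> real^2" and Y :: "'w \<Rightarrow> nat \<Rightarrow> real^2"
  assumes M: "prob_space M" "\<And>i. (\<lambda>w. X w i) \<in> borel_measurable M"
      "AE w in M. inj (\<lambda>i. norm (X w i))" "AE w in M. \<forall>R. finite {i. norm (X w i) \<le> R}"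
    and N: "prob_space N" "\<And>i. (\<lambda>w. Y w i) \<in> borel_measurable N"
      "AE w in N. inj (\<lambda>i. norm (Y w i))" "AE w in N. \<forall>R. finite {i. norm (Y w i) \<le> R}"
    and void: "\<And>A. A \<in> sets borel \<Longrightarrow> bounded A \<Longrightarrow>
      measure M {w \<in> space M. \<forall>i. X w i \<notin> A} = measure N {w \<in> space N. \<forall>i. Y w i \<notin> A}"
    and t: "0 < t"
  shows "measure M {w \<in> space M. handover (\<lambda>s i. X w i + s *\<^sub>R u) t} =
    measure N {w \<in> space N. handover (\<lambda>s i. Y w i + s *\<^sub>R u) t}"
proof -
  obtain D :: "(real^2) set" where D: "countable D" "\<And>S. open S \<Longrightarrow> S \<noteq> {} \<Longrightarrow> \<exists>d\<in>D. d \<in> S"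
    using countable_dense_exists by blast
  have [measurable]: "X \<in> measurable M (PiM UNIV (\<lambda>_. borel))" "Y \<in> measurable N (PiM UNIV (\<lambda>_. borel))"
    using M(2) N(2) by (auto intro!: measurable_PiM_single')
  let ?P = "distr M (PiM UNIV (\<lambda>_. borel)) X" and ?Q = "distr N (PiM UNIV (\<lambda>_. borel)) Y"
  have "measure ?P (steady u t D) = measure ?Q (steady u t D)"
  proof (rule void_events_determine)
    fix A :: "(real^2) set" assume A: "A \<in> sets borel" "bounded A"
    have "X -` void A \<inter> space M = {w \<in> space M. \<forall>i. X w i \<notin> A}"
      "Y -` void A \<inter> space N = {w \<in> space N. \<forall>i. Y w i \<notin> A}" by (auto simp: void_def)
    then show "measure ?P (void A) = measure ?Q (void A)"
      using void[OF A] A(1) by (simp add: measure_distr)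
  qed (auto intro!: prob_space.prob_space_distr M(1) N(1) steady_in_sigma_void D(1))
  then show ?thesis
    using prob_space.prob_handover_eq_steady[OF M t D(1), of u] prob_space.prob_handover_eq_steady[OF N t D(1), of u] D(2) by simp
qed

theorem theorem1:
  fixes M1 :: "'a measure" and M2 :: "'b measure"
    and lam v h t :: real
    and Y :: "'a \<Rightarrow> nat \<Rightarrow> real^2" and \<theta> :: "'a \<Rightarrow> real"
    and Z :: "'b \<Rightarrow> nat \<Rightarrow> real^2" and \<phi> :: "'b \<Rightarrow> nat \<Rightarrow> real"
  assumes "prob_space M1" and "prob_space M2"
    and "lam > 0" and "v > 0" and "h > 0" and "t \<ge> 0"
    and "homogeneous_PPP M1 lam Y"
    and "\<theta> \<in> borel_measurable M1"
    and "distr M1 lborel \<theta> = uniform_measure lborel {0..<2*pi}"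
    and "indep_rv M1 (PiM UNIV (\<lambda>_. borel)) Y borel \<theta>"
    and "homogeneous_PPP M2 lam Z"
    and "\<forall>i. (\<lambda>w. \<phi> w i) \<in> borel_measurable M2 \<and>
             distr M2 lborel (\<lambda>w. \<phi> w i) = uniform_measure lborel {0..<2*pi}"
    and "prob_space.indep_vars M2 (\<lambda>_. borel) (\<lambda>i w. \<phi> w i) UNIV"
    and "indep_rv M2 (PiM UNIV (\<lambda>_. borel)) Z (PiM UNIV (\<lambda>_. borel)) \<phi>"
  shows "measure M1 {w \<in> space M1. handover (\<lambda>s i. Y w i - (s * v) *\<^sub>R dir2 (\<theta> w)) t}
       = measure M2 {w \<in> space M2. handover (\<lambda>s i. lift3 (Z w i + (s * v) *\<^sub>R dir2 (\<phi> w i)) h) t}"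
proof (cases "t = 0")
  case True
  then have "\<not> handover x t" for x :: "real \<Rightarrow> nat \<Rightarrow> real^2" by (simp add: handover_def)
  moreover have "\<not> handover x t" for x :: "real \<Rightarrow> nat \<Rightarrow> real^3" using True by (simp add: handover_def)
  ultimately show ?thesis by simp
next
  case False
  then have t: "0 < t" using \<open>t \<ge> 0\<close> by simp
  have lam: "0 \<le> lam" using \<open>lam > 0\<close> by simp
  note M1 = \<open>prob_space M1\<close> and M2 = \<open>prob_space M2\<close>
    and Y = \<open>homogeneous_PPP M1 lam Y\<close> and Z = \<open>homogeneous_PPP M2 lam Z\<close>
  let ?u = "v *\<^sub>R dir2 0"
  \<comment> \<open>Relative to the UE the stations move in direction
    \<open>- dir2 (\<theta> w)\<close>. The extra \<open>pi\<close> turns this into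
    \<open>dir2 0\<close>, the direction that the aerial stations have after their own
    rotations.\<close>
  let ?Y = "\<lambda>w i. rot (pi - \<theta> w) (Y w i)" and ?Z = "\<lambda>w i. rot (- \<phi> w i) (Z w i)"
  note [measurable] = PPP_measurable[OF Y] PPP_measurable[OF Z] \<open>\<theta> \<in> borel_measurable M1\<close>
  have \<phi> [measurable]: "(\<lambda>w. \<phi> w i) \<in> borel_measurable M2" for i using assms by blast
  have "handover (\<lambda>s i. Y w i - (s * v) *\<^sub>R dir2 (\<theta> w)) t \<longleftrightarrow> handover (\<lambda>s i. ?Y w i + s *\<^sub>R ?u) t" for w
  proof (rule handover_cong)
    fix s
    have "norm (Y w i - (s * v) *\<^sub>R dir2 (\<theta> w)) = norm (?Y w i + s *\<^sub>R ?u)" for i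
    proof -
      have "dir2 pi = - dir2 0" by (simp add: dir2_def vec_eq_iff forall_2)
      then have "?Y w i + s *\<^sub>R ?u = rot (pi - \<theta> w) (Y w i + (- (s * v)) *\<^sub>R dir2 (\<theta> w))"
        by (simp only: rot_add rot_scaleR rot_dir2) simp
      then show ?thesis by (simp only: norm_rot) simp
    qed
    then show "serving (\<lambda>i. norm (Y w i - (s * v) *\<^sub>R dir2 (\<theta> w))) = serving (\<lambda>i. norm (?Y w i + s *\<^sub>R ?u))"
      by simp
  qed
  moreover have "handover (\<lambda>s i. lift3 (Z w i + (s * v) *\<^sub>R dir2 (\<phi> w i)) h) t \<longleftrightarrow> handover (\<lambda>s i. ?Z w i + s *\<^sub>R ?u) t" for w
  proof (rule handover_cong)
    fix s
    have "norm (Z w i + (s * v) *\<^sub>R dir2 (\<phi> w i)) = norm (?Z w i + s *\<^sub>R ?u)" for i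
    proof -
      have "?Z w i + s *\<^sub>R ?u = rot (- \<phi> w i) (Z w i + (s * v) *\<^sub>R dir2 (\<phi> w i))"
        by (simp only: rot_add rot_scaleR rot_dir2) simp
      then show ?thesis by (simp only: norm_rot)
    qed
    then show "serving (\<lambda>i. norm (lift3 (Z w i + (s * v) *\<^sub>R dir2 (\<phi> w i)) h)) = serving (\<lambda>i. norm (?Z w i + s *\<^sub>R ?u))"
      by (simp add: serving_def is_arg_min_def norm_lift3_less del: scaleR_scaleR)
  qed
  moreover have "measure M1 {w \<in> space M1. handover (\<lambda>s i. ?Y w i + s *\<^sub>R ?u) t} =
      measure M2 {w \<in> space M2. handover (\<lambda>s i. ?Z w i + s *\<^sub>R ?u) t}"
  proof (rule prob_handover_unique[OF M1 _ _ _ M2 _ _ _ _ t])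
    fix A :: "(real^2) set" assume A: "A \<in> sets borel" "bounded A"
    have "measure M1 {w \<in> space M1. \<forall>i. ?Y w i \<notin> A} = exp (- (lam * measure lborel A))"
      using A assms by (intro prob_space.void_common_rotation[OF M1 Y, where f = "\<lambda>a. pi - a"]) auto
    moreover have "measure M2 {w \<in> space M2. \<forall>i. ?Z w i \<notin> A} = exp (- (lam * measure lborel A))"
    proof (rule prob_space.void_iid_rotation[OF M2 Z lam _ _ _ _ _ _ A, where N = "distr M2 borel (\<lambda>w. \<phi> w 0)"
          and f = uminus and \<alpha> = \<phi>])
      \<comment> \<open>The angle laws are given over \<open>lborel\<close>, which has the same
        measurable sets as \<open>borel\<close>; equality with the law of angle 0 expresses that
        they are identically distributed.\<close>
      show "distr M2 borel (\<lambda>w. \<phi> w i) = distr M2 borel (\<lambda>w. \<phi> w 0)" for i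
        using assms(12) by (metis distr_cong sets_lborel)
    qed (use assms in \<open>auto intro: prob_space.prob_space_distr\<close>)
    ultimately show "measure M1 {w \<in> space M1. \<forall>i. ?Y w i \<notin> A} = measure M2 {w \<in> space M2. \<forall>i. ?Z w i \<notin> A}" by simp
  qed (use prob_space.PPP_inj_norm[OF M1 Y lam] prob_space.PPP_inj_norm[OF M2 Z lam]
      PPP_finite_norm[OF Y] PPP_finite_norm[OF Z] in \<open>simp_all\<close>)
  ultimately show ?thesis by simp
qed

end
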